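(* Let $a<b$ be real numbers and $I=(a,b)$. Let $V:\mathbb R\times\mathbb R\to\mathbb R$ be coercive, lower semicontinuous, diagonal and symmetric, and let $J_{1d}$ be the functional defined on $W^{1,\infty}(I)$ by $$J_{1d}(u):=\operatorname*{ess\,sup}_{(x,y)\in I\times I}V(u'(x),u'(y)).$$ Let $J_{1d}^{rlx}$ be the sequentially $W^{1,\infty}$-weak* lower semicontinuous envelope of $J_{1d}$, i.e. $$J_{1d}^{rlx}(u):=\inf\Big\{\liminf_{j\to+\infty}J_{1d}(u_j): u_j\overset{*}{\rightharpoonup}u\ \text{in } W^{1,\infty}(I)\Big\}.$$ Then, for every $u\in W^{1,\infty}(I)$, $$J_{1d}^{rlx}(u)=\operatorname*{ess\,sup}_{(x,y)\in I\times I}V^{slc}(u'(x),u'(y)),$$ where $V^{slc}$ is the separately level convex envelope of $V$.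
   Context: For a function $f:\mathbb R\times\mathbb R\to\mathbb R$ and $c\in\mathbb R$, let $L_c(f):=\{(\xi,\eta)\in\mathbb R\times\mathbb R: f(\xi,\eta)\le c\}$. $V$ is coercive if there is $C'>0$ with $C'|(\xi,\eta)|\le V(\xi,\eta)$ for all $\xi,\eta\in\mathbb R$. $V$ is symmetric if $V(\xi,\eta)=V(\eta,\xi)$ for all $\xi,\eta$. $V$ is diagonal if for every $c\in\mathbb R$, $(\xi,\eta)\in L_c(V)$ implies $(\xi,\xi),(\eta,\eta)\in L_c(V)$; equivalently $V(\xi,\eta)=\max\{V(\xi,\xi),V(\xi,\eta),V(\eta,\eta)\}$ for all $\xi,\eta$. A set $A\subset\mathbb R\times\mathbb R$ is separately convex if for all $(\xi_1,\xi_2),(\eta_1,\eta_2)\in A$ with $\xi_1=\eta_1$ or $\xi_2=\eta_2$ one has $t(\xi_1,\xi_2)+(1-t)(\eta_1,\eta_2)\in A$ for every $t\in(0,1)$. A function $f$ is separately level convex if $L_c(f)$ is separately convex for every $c\in\mathbb R$. The separately level convex envelope $V^{slc}$ is the greatest separately level convex function less than or equal to $V$. Weak* convergence $u_j\overset{*}{\rightharpoonup}u$ in $W^{1,\infty}(I)$ means $u_j\overset{*}{\rightharpoonup}u$ and $u_j'\overset{*}{\rightharpoonup}u'$ in $L^\infty(I)$. The functionals are allowed to take the value $+\infty$. *)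

theory Defs
  imports "HOL-Analysis.Analysis" "HOL-Probability.Essential_Supremum"
begin

section \<open>Densities and their level sets\<close>

definition level_set :: "(real \<times> real \<Rightarrow> real) \<Rightarrow> real \<Rightarrow> (real \<times> real) set" where
  "level_set f c = {p. f p \<le> c}"

definition coercive :: "(real \<times> real \<Rightarrow> real) \<Rightarrow> bool" where
  "coercive V \<longleftrightarrow> (\<exists>C>0. \<forall>p. C * norm p \<le> V p)"

definition lower_semicontinuous :: "('a::topological_space \<Rightarrow> real) \<Rightarrow> bool" where
  "lower_semicontinuous f \<longleftrightarrow> (\<forall>p c. c < f p \<longrightarrow> (\<forall>\<^sub>F q in nhds p. c < f q))"

definition symmetric_density :: "(real \<times> real \<Rightarrow> real) \<Rightarrow> bool" where
  "symmetric_density V \<longleftrightarrow> (\<forall>\<xi> \<eta>. V (\<xi>, \<eta>) = V (\<eta>, \<xi>))"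

definition diagonal_density :: "(real \<times> real \<Rightarrow> real) \<Rightarrow> bool" where
  "diagonal_density V \<longleftrightarrow>
     (\<forall>c \<xi> \<eta>. (\<xi>, \<eta>) \<in> level_set V c \<longrightarrow>
        (\<xi>, \<xi>) \<in> level_set V c \<and> (\<eta>, \<eta>) \<in> level_set V c)"

definition separately_convex :: "(real \<times> real) set \<Rightarrow> bool" where
  "separately_convex A \<longleftrightarrow>
     (\<forall>p\<in>A. \<forall>q\<in>A. fst p = fst q \<or> snd p = snd q \<longrightarrow>
        (\<forall>t\<in>{0<..<1}. t *\<^sub>R p + (1 - t) *\<^sub>R q \<in> A))"

definition separately_level_convex :: "(real \<times> real \<Rightarrow> real) \<Rightarrow> bool" where
  "separately_level_convex f \<longleftrightarrow> (\<forall>c. separately_convex (level_set f c))"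

text \<open>The order is the pointwise one. As \<open>GREATEST\<close> is a description operator, the next lemma
  checks that the greatest element exists whenever \<open>V\<close> is bounded below, in particular when it
  is coercive.\<close>

definition slc_envelope :: "(real \<times> real \<Rightarrow> real) \<Rightarrow> real \<times> real \<Rightarrow> real" where
  "slc_envelope V = (GREATEST f. separately_level_convex f \<and> f \<le> V)"

lemma slc_envelope_greatest:
  assumes "\<And>p. m \<le> V p"
  shows "separately_level_convex (slc_envelope V)"
    and "slc_envelope V \<le> V"
    and "\<And>f. separately_level_convex f \<Longrightarrow> f \<le> V \<Longrightarrow> f \<le> slc_envelope V"
proof -
  define F where "F = {f. separately_level_convex f \<and> f \<le> V}"
  define g where "g = (\<lambda>p. SUP f\<in>F. f p)"
  have const: "(\<lambda>_. m) \<in> F"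
    using assms
    by (auto simp: F_def separately_level_convex_def separately_convex_def level_set_def intro: le_funI)
  have bdd: "bdd_above ((\<lambda>f. f p) ` F)" for p
    by (rule bdd_aboveI[of _ "V p"]) (auto simp: F_def dest: le_funD)
  have g_le_iff: "g p \<le> c \<longleftrightarrow> (\<forall>f\<in>F. f p \<le> c)" for p c
    unfolding g_def using const bdd by (subst cSUP_le_iff) auto
  have level: "level_set g c = (\<Inter>f\<in>F. level_set f c)" for c
    by (auto simp: level_set_def g_le_iff)
  have "separately_level_convex g"
    unfolding separately_level_convex_def level separately_convex_def
    by (auto simp: F_def separately_level_convex_def separately_convex_def)
  moreover have "g \<le> V"
    by (rule le_funI) (auto simp: g_le_iff F_def dest: le_funD)
  moreover have "f \<le> g" if "f \<in> F" for f
    using that g_le_iff by (intro le_funI) blast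
  moreover from calculation have "slc_envelope V = g"
    unfolding slc_envelope_def by (intro Greatest_equality) (auto simp: F_def)
  ultimately show "separately_level_convex (slc_envelope V)" "slc_envelope V \<le> V"
    "\<And>f. separately_level_convex f \<Longrightarrow> f \<le> V \<Longrightarrow> f \<le> slc_envelope V"
    by (auto simp: F_def)
qed

section \<open>The space \<open>W\<^sup>1\<^sup>,\<^sup>\<infinity>(I)\<close>\<close>

text \<open>Elements of \<open>L\<^sup>\<infinity>(I)\<close> and \<open>W\<^sup>1\<^sup>,\<^sup>\<infinity>(I)\<close> are represented by functions on the whole line;
  values outside \<open>I\<close> and on null sets never matter.\<close>

definition Linf :: "real set \<Rightarrow> (real \<Rightarrow> real) set" where
  "Linf I = {f. f \<in> borel_measurable (lebesgue_on I) \<and> (\<exists>C. AE x in lebesgue_on I. \<bar>f x\<bar> \<le> C)}"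

text \<open>\<open>C\<^sub>c\<^sup>\<infinity>(I)\<close>\<close>

definition test_functions :: "real set \<Rightarrow> (real \<Rightarrow> real) set" where
  "test_functions I =
     {\<phi>. (\<forall>n x. (deriv ^^ n) \<phi> differentiable (at x)) \<and>
         compact (closure {x. \<phi> x \<noteq> 0}) \<and> closure {x. \<phi> x \<noteq> 0} \<subseteq> I}"

definition weak_deriv :: "real set \<Rightarrow> (real \<Rightarrow> real) \<Rightarrow> (real \<Rightarrow> real) \<Rightarrow> bool" where
  "weak_deriv I u g \<longleftrightarrow>
     (\<forall>\<phi>\<in>test_functions I.
        (LINT x|lebesgue_on I. u x * deriv \<phi> x) = - (LINT x|lebesgue_on I. g x * \<phi> x))"

definition W1inf :: "real set \<Rightarrow> (real \<Rightarrow> real) set" where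
  "W1inf I = {u \<in> Linf I. \<exists>g\<in>Linf I. weak_deriv I u g}"

text \<open>A representative of \<open>u'\<close>; for open \<open>I\<close> any two choices agree almost everywhere on \<open>I\<close>.\<close>

definition wderiv :: "real set \<Rightarrow> (real \<Rightarrow> real) \<Rightarrow> real \<Rightarrow> real" where
  "wderiv I u = (SOME g. g \<in> Linf I \<and> weak_deriv I u g)"

text \<open>\<open>L\<^sup>\<infinity>(I)\<close> as the dual of \<open>L\<^sup>1(I)\<close>.\<close>

definition weakstar_Linf :: "real set \<Rightarrow> (nat \<Rightarrow> real \<Rightarrow> real) \<Rightarrow> (real \<Rightarrow> real) \<Rightarrow> bool" where
  "weakstar_Linf I f g \<longleftrightarrow>
     (\<forall>h. integrable (lebesgue_on I) h \<longrightarrow>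
        (\<lambda>j. LINT x|lebesgue_on I. f j x * h x) \<longlonglongrightarrow> (LINT x|lebesgue_on I. g x * h x))"

definition weakstar_W1inf :: "real set \<Rightarrow> (nat \<Rightarrow> real \<Rightarrow> real) \<Rightarrow> (real \<Rightarrow> real) \<Rightarrow> bool" where
  "weakstar_W1inf I u v \<longleftrightarrow>
     weakstar_Linf I u v \<and> weakstar_Linf I (\<lambda>j. wderiv I (u j)) (wderiv I v)"

section \<open>The functionals\<close>

definition J1d :: "real set \<Rightarrow> (real \<times> real \<Rightarrow> real) \<Rightarrow> (real \<Rightarrow> real) \<Rightarrow> ereal" where
  "J1d I V u =
     esssup (lebesgue_on (I \<times> I)) (\<lambda>(x, y). ereal (V (wderiv I u x, wderiv I u y)))"

definition J1d_rlx :: "real set \<Rightarrow> (real \<times> real \<Rightarrow> real) \<Rightarrow> (real \<Rightarrow> real) \<Rightarrow> ereal" where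
  "J1d_rlx I V u =
     Inf {liminf (\<lambda>j. J1d I V (v j)) | v. (\<forall>j. v j \<in> W1inf I) \<and> weakstar_W1inf I v u}"

end

theory Submission
  imports Defs
begin

text \<open>Both sides of the identity have the same real sublevels. For a real \<open>c\<close>, each of them is at
  most \<open>c\<close> exactly when the derivative of \<open>u\<close> takes almost all its values in one interval \<open>[\<alpha>, \<beta>]\<close>
  with \<open>V (\<alpha>, \<beta>) \<le> c\<close>; this condition is \<open>range_in_square\<close>.

  On the right-hand side, diagonality and symmetry of \<open>V\<close> bound \<open>V\<close> by \<open>c\<close> at all four corners of
  \<open>[\<alpha>, \<beta>]\<^sup>2\<close> once \<open>V (\<alpha>, \<beta>) \<le> c\<close>, so separate convexity fills the square. Conversely the union of all
  these squares is already separately convex, because the squares are centred on the diagonal. Hence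
  the sublevel set of the envelope is exactly the union of the squares
  (\<open>slc_envelope_le_iff\<close>). If almost every pair \<open>(u' x, u' y)\<close> lies in some square, take the first value
  close to the essential infimum of \<open>u'\<close> and the second close to its essential supremum; compactness of
  the sublevel sets of \<open>V\<close> yields one square for all pairs (\<open>esssup_slc_envelope_le_iff\<close>).

  On the left-hand side, a function with \<open>J1d\<close> at most \<open>c\<close> has its derivative in such an interval.
  Along a weak* convergent sequence the intervals converge up to a subsequence, the bound on \<open>V\<close>
  passes to the limit by lower semicontinuity, and pointwise bounds on the derivatives are weak*
  closed (\<open>J1d_rlx_le_imp_range_in_square\<close>). Conversely, if \<open>\<alpha> \<le> u' \<le> \<beta>\<close>, let the derivative oscillate
  between \<open>\<alpha>\<close> and \<open>\<beta>\<close> on finer and finer scales with local averages \<open>u'\<close>. Such functions converge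
  weakly* to \<open>u\<close>, and \<open>J1d\<close> evaluates \<open>V\<close> on them only at the four corners of \<open>[\<alpha>, \<beta>]\<^sup>2\<close>, where it is at
  most \<open>c\<close> (\<open>range_in_square_imp_J1d_rlx_le\<close>).

  The recovery sequence rests on three facts of one-dimensional analysis: weak derivatives are unique
  almost everywhere (\<open>weak_deriv_unique\<close>), primitives of bounded functions have
  the expected weak derivative (\<open>primitive_weak_deriv\<close>), and bounded sequences whose primitives tend
  to 0 tend to 0 weakly* (\<open>weakstar_null_from_primitives\<close>).\<close>

section \<open>The separately level convex envelope\<close>

lemma coercive_nonneg:
  assumes "coercive V"
  shows "0 \<le> V p"
proof -
  obtain C where C: "C > 0" "C * norm p \<le> V p"
    using assms unfolding coercive_def by blast
  have "0 \<le> C * norm p" using C(1) by simp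
  with C(2) show ?thesis by linarith
qed

text \<open>Every limiting argument on the density goes through this form of compactness: coercivity
  bounds the points, and lower semicontinuity passes the bound on \<open>V\<close> to the limit. The levels
  may vary with \<open>n\<close>, which serves both fixed levels and levels decreasing to \<open>c\<close>.\<close>

lemma coercive_lsc_compactness:
  assumes V: "coercive V" "lower_semicontinuous V"
    and le: "\<And>n. V (X n) \<le> C n" and C: "C \<longlonglongrightarrow> c"
  obtains l r where "strict_mono (r :: nat \<Rightarrow> nat)" "(X \<circ> r) \<longlonglongrightarrow> l" "V l \<le> c"
proof -
  obtain K where K: "K > 0" "\<And>p. K * norm p \<le> V p"
    using V(1) unfolding coercive_def by blast
  have "bounded (range C)"
    using C convergent_imp_bounded by blast
  then obtain B where B: "\<And>n. \<bar>C n\<bar> \<le> B"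
    unfolding bounded_iff by auto
  have "X n \<in> cball 0 (B / K)" for n
  proof -
    have "K * norm (X n) \<le> B"
      using K(2)[of "X n"] le[of n] B[of n] by linarith
    then show ?thesis using K(1) by (simp add: field_simps)
  qed
  then obtain l r where lr: "strict_mono (r :: nat \<Rightarrow> nat)" "(X \<circ> r) \<longlonglongrightarrow> l"
    using compact_cball[of "0 :: real \<times> real" "B / K"] unfolding compact_def by metis
  have "V l \<le> c"
  proof (rule ccontr)
    assume "\<not> V l \<le> c"
    then obtain c' where c': "c < c'" "c' < V l"
      using dense[of c "V l"] by auto
    have "\<forall>\<^sub>F n in sequentially. c' < V ((X \<circ> r) n)"
      using V(2) c'(2) lr(2) unfolding lower_semicontinuous_def filterlim_iff by blast
    moreover have "\<forall>\<^sub>F n in sequentially. C (r n) < c'"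
      using LIMSEQ_subseq_LIMSEQ[OF C lr(1)] c'(1) by (auto dest: order_tendstoD simp: o_def)
    ultimately have "\<forall>\<^sub>F n in sequentially. False"
    proof eventually_elim
      case (elim n)
      with le[of "r n"] show ?case by simp
    qed
    then show False by simp
  qed
  with lr that show ?thesis by blast
qed

text \<open>The squares \<open>[\<alpha>, \<beta>]\<^sup>2\<close> with \<open>V (\<alpha>, \<beta>) \<le> c\<close> turn out to fill the sublevel set of the separately
  level convex envelope. If \<open>\<beta> < \<alpha>\<close> the square is empty, so no ordering has to be imposed.\<close>

definition in_square :: "(real \<times> real \<Rightarrow> real) \<Rightarrow> real \<Rightarrow> real \<times> real \<Rightarrow> bool" where
  "in_square V c p \<longleftrightarrow> (\<exists>\<alpha> \<beta>. V (\<alpha>, \<beta>) \<le> c \<and> fst p \<in> {\<alpha>..\<beta>} \<and> snd p \<in> {\<alpha>..\<beta>})"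

text \<open>This is where diagonality and symmetry enter: the level of one corner \<open>(\<alpha>, \<beta>)\<close> bounds
  the level of all four corners of the square. A function whose derivative takes only the values
  \<open>\<alpha>\<close> and \<open>\<beta>\<close> sees the density at these four corners only.\<close>

lemma vertices_in_level_set:
  assumes "diagonal_density V" "symmetric_density V" "V (\<alpha>, \<beta>) \<le> c"
    and "s \<in> {\<alpha>, \<beta>}" "t \<in> {\<alpha>, \<beta>}"
  shows "V (s, t) \<le> c"
  using assms unfolding diagonal_density_def symmetric_density_def level_set_def
  by (elim insertE emptyE) (simp_all, metis+)

lemma in_square_swap: "in_square V c (x, y) \<longleftrightarrow> in_square V c (y, x)"
  unfolding in_square_def by auto

text \<open>The squares are all centred on the diagonal. Two of them that meet an axis-parallel line both
  contain the diagonal point of that line, so their traces on it overlap there and form one interval.\<close>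

lemma separately_convex_in_square:
  "separately_convex {p. in_square V c p}"
proof -
  have conv: "t * x + (1 - t) * x = (x::real)" for t x by (simp add: algebra_simps)
  have key: "\<exists>\<alpha> \<beta>. V (\<alpha>, \<beta>) \<le> c \<and> x \<in> {\<alpha>..\<beta>} \<and> t * y + (1 - t) * z \<in> {\<alpha>..\<beta>}"
    if 1: "V (\<alpha>, \<beta>) \<le> c" "x \<in> {\<alpha>..\<beta>}" "y \<in> {\<alpha>..\<beta>}"
      and 2: "V (\<gamma>, \<delta>) \<le> c" "x \<in> {\<gamma>..\<delta>}" "z \<in> {\<gamma>..\<delta>}"
      and t: "t \<in> {0<..<1}" for \<alpha> \<beta> \<gamma> \<delta> x y z t
  proof -
    define w where "w = t * y + (1 - t) * z"
    have w: "min y z \<le> w" "w \<le> max y z"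
    proof -
      have "t * min y z + (1 - t) * min y z \<le> w" "w \<le> t * max y z + (1 - t) * max y z"
        unfolding w_def using t by (auto intro!: add_mono mult_left_mono)
      then show "min y z \<le> w" "w \<le> max y z" by (simp_all add: conv)
    qed
    \<comment> \<open>Both squares contain the shared coordinate \<open>x\<close>, so the part of the segment on either side
      of \<open>x\<close> stays in the square of the endpoint on that side.\<close>
    have "w \<in> {\<alpha>..\<beta>} \<or> w \<in> {\<gamma>..\<delta>}"
      using w 1 2 by (auto simp: min_def max_def split: if_splits)
    then show ?thesis using 1 2 unfolding w_def by blast
  qed
  show ?thesis
    unfolding separately_convex_def
  proof safe
    fix p1 p2 q1 q2 t
    assume pq: "in_square V c (p1, p2)" "in_square V c (q1, q2)"
      and t: "(t::real) \<in> {0<..<1}"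
    show "in_square V c (t *\<^sub>R (p1, p2) + (1 - t) *\<^sub>R (q1, q2))" if "fst (p1, p2) = fst (q1, q2)"
      using pq that t key[of _ _ p1 p2 _ _ q2 t] unfolding in_square_def by (auto simp: conv)
    show "in_square V c (t *\<^sub>R (p1, p2) + (1 - t) *\<^sub>R (q1, q2))" if "snd (p1, p2) = snd (q1, q2)"
    proof -
      have "in_square V c (p2, t * p1 + (1 - t) * q1)"
        using pq that t key[of _ _ p2 p1 _ _ q1 t] unfolding in_square_def by (auto simp: conv)
      then have "in_square V c (t * p1 + (1 - t) * q1, p2)"
        by (subst in_square_swap)
      then show ?thesis using that by (simp add: conv)
    qed
  qed
qed

text \<open>Used with a fixed point, this says that the infimum of the levels of the squares around it is
  attained; with a fixed level, that the union of the squares is closed.\<close>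

lemma in_square_limit:
  assumes V: "coercive V" "lower_semicontinuous V"
    and sq: "\<And>n. in_square V (C n) (p n)"
    and C: "C \<longlonglongrightarrow> c" and p: "p \<longlonglongrightarrow> p'"
  shows "in_square V c p'"
proof -
  have "\<exists>q. V q \<le> C n \<and> fst (p n) \<in> {fst q..snd q} \<and> snd (p n) \<in> {fst q..snd q}" for n
    using sq[of n] unfolding in_square_def by force
  then obtain X where X: "\<And>n. V (X n) \<le> C n"
    "\<And>n. fst (p n) \<in> {fst (X n)..snd (X n)} \<and> snd (p n) \<in> {fst (X n)..snd (X n)}"
    by metis
  obtain l r where lr: "strict_mono (r :: nat \<Rightarrow> nat)" "(X \<circ> r) \<longlonglongrightarrow> l" "V l \<le> c"
    by (rule coercive_lsc_compactness[OF V X(1) C])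
  have pr: "(p \<circ> r) \<longlonglongrightarrow> p'"
    by (rule LIMSEQ_subseq_LIMSEQ[OF p lr(1)])
  have X': "fst ((X \<circ> r) n) \<le> fst ((p \<circ> r) n)" "fst ((X \<circ> r) n) \<le> snd ((p \<circ> r) n)"
    "fst ((p \<circ> r) n) \<le> snd ((X \<circ> r) n)" "snd ((p \<circ> r) n) \<le> snd ((X \<circ> r) n)" for n
    using X(2)[of "r n"] by simp_all
  note lims = tendsto_fst[OF lr(2)] tendsto_snd[OF lr(2)] tendsto_fst[OF pr] tendsto_snd[OF pr]
  have "fst l \<le> fst p'" "fst l \<le> snd p'" "fst p' \<le> snd l" "snd p' \<le> snd l"
    using X' LIMSEQ_le[OF lims(1) lims(3)] LIMSEQ_le[OF lims(1) lims(4)]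
      LIMSEQ_le[OF lims(3) lims(2)] LIMSEQ_le[OF lims(4) lims(2)] by blast+
  then show ?thesis
    unfolding in_square_def using lr(3) by (intro exI[of _ "fst l"] exI[of _ "snd l"]) auto
qed

text \<open>The squares lie in the sublevel set of the envelope, since separate convexity fills a square from
  its four corners. Conversely, the least level of a square around \<open>p\<close>, as a function of \<open>p\<close>, has
  unions of squares as sublevel sets; it is separately level convex and below \<open>V\<close>, hence below the
  envelope.\<close>

lemma slc_envelope_le_iff:
  assumes V: "coercive V" "lower_semicontinuous V" "diagonal_density V" "symmetric_density V"
  shows "slc_envelope V p \<le> c \<longleftrightarrow> in_square V c p"
proof
  note slc = slc_envelope_greatest[of 0 V, OF coercive_nonneg[OF V(1)]]
  assume "in_square V c p"
  then obtain \<alpha> \<beta> where ab: "V (\<alpha>, \<beta>) \<le> c" "fst p \<in> {\<alpha>..\<beta>}" "snd p \<in> {\<alpha>..\<beta>}"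
    unfolding in_square_def by blast
  let ?L = "level_set (slc_envelope V) c"
  have vert: "(s, t) \<in> ?L" if "s \<in> {\<alpha>, \<beta>}" "t \<in> {\<alpha>, \<beta>}" for s t
  proof -
    have "slc_envelope V (s, t) \<le> V (s, t)"
      using slc(2) by (rule le_funD)
    then show ?thesis
      using vertices_in_level_set[OF V(3,4) ab(1) that] unfolding level_set_def by simp
  qed
  have sep: "t *\<^sub>R p + (1 - t) *\<^sub>R q \<in> ?L"
    if "p \<in> ?L" "q \<in> ?L" "fst p = fst q \<or> snd p = snd q" "t \<in> {0..1}" for p q t
  proof (cases "t = 0 \<or> t = 1")
    case False
    then have "t \<in> {0<..<1}" using that(4) by auto
    then show ?thesis
      using slc(1) that(1-3) unfolding separately_level_convex_def separately_convex_def by blast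
  qed (use that in auto)
  have comb: "\<exists>t\<in>{0..1}. x = t * \<alpha> + (1 - t) * \<beta>" if "x \<in> {\<alpha>..\<beta>}" for x
  proof -
    have "x \<in> closed_segment \<beta> \<alpha>"
      using that by (simp add: closed_segment_eq_real_ivl)
    then show ?thesis by (auto simp: closed_segment_def algebra_simps)
  qed
  \<comment> \<open>Fill in the two vertical edges of the square first, then join them horizontally.\<close>
  obtain t where t: "t \<in> {0..1}" "snd p = t * \<alpha> + (1 - t) * \<beta>" using comb[OF ab(3)] by blast
  have edge: "(s, snd p) \<in> ?L" if "s \<in> {\<alpha>, \<beta>}" for s
  proof -
    have "t *\<^sub>R (s, \<alpha>) + (1 - t) *\<^sub>R (s, \<beta>) = (s, snd p)"
      using t(2) by (simp add: left_diff_distrib)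
    then show ?thesis using sep[OF vert[OF that, of \<alpha>] vert[OF that, of \<beta>] _ t(1)] by simp
  qed
  obtain s where s: "s \<in> {0..1}" "fst p = s * \<alpha> + (1 - s) * \<beta>" using comb[OF ab(2)] by blast
  have "(fst p, snd p) \<in> ?L"
  proof -
    have "s *\<^sub>R (\<alpha>, snd p) + (1 - s) *\<^sub>R (\<beta>, snd p) = (fst p, snd p)"
      using s(2) by (simp add: left_diff_distrib)
    then show ?thesis using sep[OF edge[of \<alpha>] edge[of \<beta>] _ s(1)] by simp
  qed
  then show "slc_envelope V p \<le> c" unfolding level_set_def by simp
next
  note slc = slc_envelope_greatest[of 0 V, OF coercive_nonneg[OF V(1)]]
  assume le: "slc_envelope V p \<le> c"
  define f where "f = (\<lambda>p. Inf {c. in_square V c p})"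
  have nonneg: "0 \<le> c" if "in_square V c p" for c p
    using that coercive_nonneg[OF V(1)] unfolding in_square_def by (meson order_trans)
  have mono: "in_square V c' p" if "in_square V c p" "c \<le> c'" for c c' p
    using that unfolding in_square_def by (meson order_trans)
  have self: "in_square V (V p) p" for p
  proof (cases "fst p \<le> snd p")
    case True
    then show ?thesis
      unfolding in_square_def by (intro exI[of _ "fst p"] exI[of _ "snd p"]) simp
  next
    case False
    have "V (snd p, fst p) \<le> V p"
      using V(4)[unfolded symmetric_density_def, rule_format, of "snd p" "fst p"] by simp
    with False show ?thesis
      unfolding in_square_def by (intro exI[of _ "snd p"] exI[of _ "fst p"]) simp
  qed
  have bdd: "bdd_below {c. in_square V c p}" for p
    using nonneg by (intro bdd_belowI[of _ 0]) auto
  have f_le: "f p \<le> c \<longleftrightarrow> in_square V c p" for c p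
  proof
    assume "in_square V c p"
    then show "f p \<le> c" unfolding f_def by (intro cInf_lower bdd) auto
  next
    assume fc: "f p \<le> c"
    have near: "in_square V (c + 1 / Suc n) p" for n
    proof -
      have "Inf {c. in_square V c p} < c + 1 / Suc n"
        using fc unfolding f_def by (rule le_less_trans) simp
      then obtain d where "in_square V d p" "d < c + 1 / Suc n"
        using self[of p] by (subst (asm) cInf_less_iff[OF _ bdd]) auto
      then show ?thesis using mono by auto
    qed
    have "(\<lambda>n. c + 1 / Suc n) \<longlonglongrightarrow> c"
      using tendsto_add[OF tendsto_const lim_1_over_n[THEN LIMSEQ_Suc], of c] by simp
    from in_square_limit[OF V(1,2) near this tendsto_const] show "in_square V c p" .
  qed
  \<comment> \<open>The greatest-element property of the envelope applies to the least square level.\<close>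
  have "f \<le> slc_envelope V"
  proof (rule slc(3))
    show "separately_level_convex f"
      unfolding separately_level_convex_def level_set_def f_le
      using separately_convex_in_square by blast
    show "f \<le> V" using f_le self by (auto intro: le_funI)
  qed
  then have "f p \<le> c" using le by (meson le_funD order_trans)
  then show "in_square V c p" using f_le by simp
qed

lemma slc_envelope_borel:
  assumes V: "coercive V" "lower_semicontinuous V" "diagonal_density V" "symmetric_density V"
  shows "slc_envelope V \<in> borel_measurable borel"
proof (rule borel_measurableI_le)
  fix c
  have "closed {p. in_square V c p}"
    unfolding closed_sequential_limits
    using in_square_limit[OF V(1,2) _ tendsto_const] by blast
  then show "{p \<in> space borel. slc_envelope V p \<le> c} \<in> sets borel"
    by (simp add: slc_envelope_le_iff[OF V])
qed

section \<open>Essential bounds and products of the interval\<close>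

text \<open>The essential infimum as a real number. The second property is the one that
  produces points at which \<open>g\<close> is almost minimal.\<close>

lemma essential_lower_bound:
  fixes g :: "'a \<Rightarrow> real"
  assumes bdd: "AE x in M. \<bar>g x\<bar> \<le> C" and M: "\<not> (AE x in M. False)"
  obtains m where "AE x in M. m \<le> g x" "\<And>t. m < t \<Longrightarrow> \<not> (AE x in M. t \<le> g x)"
proof
  define S where "S = {t. AE x in M. t \<le> g x}"
  have ne: "- C \<in> S"
    unfolding S_def using bdd by auto
  have bdd_S: "bdd_above S"
  proof (rule bdd_aboveI)
    fix t assume "t \<in> S"
    then have "AE x in M. t \<le> g x" by (simp add: S_def)
    with bdd have "AE x in M. t \<le> C" by eventually_elim auto
    then show "t \<le> C" using M by (metis (mono_tags, lifting) AE_cong)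
  qed
  have "AE x in M. Sup S - 1 / Suc n \<le> g x" for n
  proof -
    have "Sup S - 1 / Suc n < Sup S" by simp
    then obtain t where t: "t \<in> S" "Sup S - 1 / Suc n < t"
      using less_cSup_iff[OF _ bdd_S] ne by blast
    from t(1) have "AE x in M. t \<le> g x" by (simp add: S_def)
    then show ?thesis by eventually_elim (use t(2) in linarith)
  qed
  then have "AE x in M. \<forall>n. Sup S - 1 / Suc n \<le> g x"
    by (simp add: AE_all_countable)
  then show "AE x in M. Sup S \<le> g x"
  proof eventually_elim
    case (elim x)
    have "(\<lambda>n. Sup S - 1 / Suc n) \<longlonglongrightarrow> Sup S - 0"
      by (intro tendsto_diff tendsto_const lim_1_over_n[THEN LIMSEQ_Suc])
    from LIMSEQ_le_const2[OF this, of "g x"] elim show ?case by simp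
  qed
  show "\<not> (AE x in M. t \<le> g x)" if "Sup S < t" for t
  proof
    assume "AE x in M. t \<le> g x"
    then have "t \<in> S" by (simp add: S_def)
    then show False using cSup_upper[OF _ bdd_S] that by fastforce
  qed
qed

text \<open>Lebesgue measure on the plane is the completion of the Borel product, not a product of
  completed measures, so the section theorem is applied to \<open>lborel\<close> and the completion is added
  afterwards on each side.\<close>

lemma AE_lebesgue_plane_sections:
  assumes I: "I \<in> sets lebesgue" and ae: "AE p in lebesgue_on (I \<times> I). Q p"
    and sq: "I \<times> I \<in> sets (lebesgue :: (real \<times> real) measure)"
  shows "AE x in lebesgue_on (I :: real set). AE y in lebesgue_on I. Q (x, y)"
proof -
  have "AE p in lborel. p \<in> I \<times> I \<longrightarrow> Q p"
    using ae sq by (simp add: AE_restrict_space_iff AE_completion_iff)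
  then have "AE p in lborel \<Otimes>\<^sub>M lborel. p \<in> I \<times> I \<longrightarrow> Q p"
    unfolding lborel_prod .
  then have "AE x in lborel. AE y in lborel. (x, y) \<in> I \<times> I \<longrightarrow> Q (x, y)"
    by (rule lborel_pair.AE_pair)
  then have "AE x in lborel. x \<in> I \<longrightarrow> (AE y in lborel. y \<in> I \<longrightarrow> Q (x, y))"
    by eventually_elim auto
  then show ?thesis
    using I by (simp add: AE_restrict_space_iff AE_completion_iff)
qed

lemma null_set_strips:
  assumes "N \<in> null_sets (lborel :: real measure)"
  shows "N \<times> UNIV \<in> null_sets (lborel :: (real \<times> real) measure)"
    and "UNIV \<times> N \<in> null_sets (lborel :: (real \<times> real) measure)"
proof -
  have N: "N \<in> sets borel" "emeasure lborel N = 0" using assms by auto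
  have "emeasure (lborel \<Otimes>\<^sub>M lborel) (N \<times> (UNIV :: real set)) = 0"
    using N by (subst lborel.emeasure_pair_measure_Times) auto
  then show "N \<times> UNIV \<in> null_sets (lborel :: (real \<times> real) measure)"
    using N by (auto simp: lborel_prod null_sets_def intro: borel_Times)
  have "emeasure (lborel \<Otimes>\<^sub>M lborel) ((UNIV :: real set) \<times> N) = 0"
    using N by (subst lborel.emeasure_pair_measure_Times) auto
  then show "UNIV \<times> N \<in> null_sets (lborel :: (real \<times> real) measure)"
    using N by (auto simp: lborel_prod null_sets_def intro: borel_Times)
qed

text \<open>Measurability into the completed \<sigma>-algebra of the line holds because the projections pull null
  sets back to null strips.\<close>

lemma fst_snd_lebesgue_measurable:
  "fst \<in> (lebesgue :: (real \<times> real) measure) \<rightarrow>\<^sub>M lebesgue"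
  "snd \<in> (lebesgue :: (real \<times> real) measure) \<rightarrow>\<^sub>M lebesgue"
proof -
  have "fst \<in> (borel :: (real \<times> real) measure) \<rightarrow>\<^sub>M borel" "snd \<in> (borel :: (real \<times> real) measure) \<rightarrow>\<^sub>M borel"
    by (auto intro!: borel_measurable_continuous_onI continuous_on_fst continuous_on_snd continuous_on_id)
  then have m: "fst \<in> (lebesgue :: (real \<times> real) measure) \<rightarrow>\<^sub>M lborel"
    "snd \<in> (lebesgue :: (real \<times> real) measure) \<rightarrow>\<^sub>M lborel"
    by (auto intro: measurable_completion)
  have "fst -` N = N \<times> (UNIV :: real set)" "snd -` N = (UNIV :: real set) \<times> N" for N :: "real set"
    by auto
  then have "N \<in> null_sets (distr lebesgue lborel (fst :: real \<times> real \<Rightarrow> real))"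
    "N \<in> null_sets (distr lebesgue lborel (snd :: real \<times> real \<Rightarrow> real))"
    if "N \<in> null_sets lborel" for N
    using null_set_strips[OF that] that m by (auto simp: null_sets_def emeasure_distr)
  with m show "fst \<in> (lebesgue :: (real \<times> real) measure) \<rightarrow>\<^sub>M lebesgue"
    "snd \<in> (lebesgue :: (real \<times> real) measure) \<rightarrow>\<^sub>M lebesgue"
    by (blast intro: completion.measurable_completion2)+
qed

lemma AE_lebesgue_plane_coordinates:
  assumes I: "(I :: real set) \<in> sets lebesgue" and ae: "AE x in lebesgue_on I. R x"
    and sq: "I \<times> I \<in> sets (lebesgue :: (real \<times> real) measure)"
  shows "AE p in lebesgue_on (I \<times> I). R (fst p) \<and> R (snd p)"
proof -
  have "AE x in lborel. x \<in> I \<longrightarrow> R x"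
    using ae I by (simp add: AE_restrict_space_iff AE_completion_iff)
  then obtain N where N: "N \<in> null_sets lborel" "{x. \<not> (x \<in> I \<longrightarrow> R x)} \<subseteq> N"
    by (auto elim!: AE_E simp: null_sets_def)
  from AE_not_in[OF null_set_strips(1)[OF N(1)]] AE_not_in[OF null_set_strips(2)[OF N(1)]]
  have "AE p in lborel. p \<in> I \<times> I \<longrightarrow> R (fst p) \<and> R (snd p)"
    by eventually_elim (use N(2) in auto)
  then have "AE p in lebesgue. p \<in> I \<times> I \<longrightarrow> R (fst p) \<and> R (snd p)"
    by (rule AE_completion)
  moreover have "I \<times> I \<inter> space lebesgue \<in> sets lebesgue" using sq by simp
  ultimately show ?thesis using AE_restrict_space_iff by blast
qed

lemma interval_square_lebesgue:
  "{a<..<b::real} \<times> {a<..<b} \<in> sets (lebesgue :: (real \<times> real) measure)"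
  by (simp add: open_Times borel_open sets_completionI_sets)

lemma coordinates_measurable:
  fixes g :: "real \<Rightarrow> real"
  assumes g: "g \<in> borel_measurable (lebesgue_on {a<..<b})"
  shows "(\<lambda>p. (g (fst p), g (snd p))) \<in> lebesgue_on ({a<..<b} \<times> {a<..<b}) \<rightarrow>\<^sub>M (borel :: (real \<times> real) measure)"
proof -
  have "fst \<in> lebesgue_on ({a<..<b} \<times> {a<..<b}) \<rightarrow>\<^sub>M lebesgue_on {a<..<b}"
    by (rule measurable_restrict_space3[OF fst_snd_lebesgue_measurable(1)]) auto
  moreover have "snd \<in> lebesgue_on ({a<..<b} \<times> {a<..<b}) \<rightarrow>\<^sub>M lebesgue_on {a<..<b}"
    by (rule measurable_restrict_space3[OF fst_snd_lebesgue_measurable(2)]) auto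
  ultimately show ?thesis
    unfolding borel_prod[symmetric] by (intro measurable_Pair measurable_compose[OF _ g])
qed

lemma lower_semicontinuous_borel:
  fixes f :: "'a::topological_space \<Rightarrow> real"
  assumes "lower_semicontinuous f"
  shows "f \<in> borel_measurable borel"
proof (rule borel_measurableI_greater)
  fix c
  have "\<exists>T. open T \<and> p \<in> T \<and> T \<subseteq> {p. c < f p}" if "c < f p" for p
  proof -
    have "\<forall>\<^sub>F q in nhds p. c < f q"
      using assms that unfolding lower_semicontinuous_def by simp
    then show ?thesis unfolding eventually_nhds by (simp add: subset_eq)
  qed
  then have "open {p. c < f p}"
    by (subst open_subopen) simp
  then show "{p \<in> space borel. c < f p} \<in> sets borel" by simp
qed

section \<open>Bounded measurable functions on a set\<close>

lemma borel_lebesgue_on: "f \<in> borel_measurable borel \<Longrightarrow> f \<in> borel_measurable (lebesgue_on I)"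
  by (intro measurable_restrict_space1 measurable_completion) auto

lemma Linf_mult:
  assumes "f \<in> Linf I" "g \<in> Linf I"
  shows "(\<lambda>x. f x * g x) \<in> Linf I"
proof -
  obtain C D where C: "AE x in lebesgue_on I. \<bar>f x\<bar> \<le> C" and D: "AE x in lebesgue_on I. \<bar>g x\<bar> \<le> D"
    using assms unfolding Linf_def by blast
  from C D have "AE x in lebesgue_on I. \<bar>f x * g x\<bar> \<le> C * D"
    by eventually_elim (auto simp: abs_mult intro!: mult_mono)
  then show ?thesis using assms unfolding Linf_def by auto
qed

lemma Linf_add:
  assumes "f \<in> Linf I" "g \<in> Linf I"
  shows "(\<lambda>x. f x + g x) \<in> Linf I"
proof -
  obtain C D where C: "AE x in lebesgue_on I. \<bar>f x\<bar> \<le> C" and D: "AE x in lebesgue_on I. \<bar>g x\<bar> \<le> D"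
    using assms unfolding Linf_def by blast
  from C D have "AE x in lebesgue_on I. \<bar>f x + g x\<bar> \<le> C + D"
    by eventually_elim (auto intro: order_trans[OF abs_triangle_ineq])
  then show ?thesis using assms unfolding Linf_def by auto
qed

lemma Linf_const: "(\<lambda>_. c) \<in> Linf I"
  unfolding Linf_def by auto

lemma Linf_diff:
  assumes "f \<in> Linf I" "g \<in> Linf I"
  shows "(\<lambda>x. f x - g x) \<in> Linf I"
  using Linf_add[OF assms(1) Linf_mult[OF Linf_const[of "-1"] assms(2)]] by simp

lemma Linf_integrable:
  assumes "f \<in> Linf I" "I \<in> lmeasurable"
  shows "integrable (lebesgue_on I) f"
proof -
  interpret finite_measure "lebesgue_on I" by (rule finite_measure_lebesgue_on[OF assms(2)])
  obtain C where C: "AE x in lebesgue_on I. norm (f x) \<le> C"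
    using assms(1) unfolding Linf_def by auto
  moreover have "f \<in> borel_measurable (lebesgue_on I)"
    using assms(1) unfolding Linf_def by blast
  ultimately show ?thesis by (rule integrable_const_bound)
qed

lemma Linf_mult_integrable:
  assumes f: "f \<in> Linf I" and h: "integrable (lebesgue_on I) h"
  shows "integrable (lebesgue_on I) (\<lambda>x. f x * h x)"
proof -
  obtain C where C: "AE x in lebesgue_on I. \<bar>f x\<bar> \<le> C" and [measurable]: "f \<in> borel_measurable (lebesgue_on I)"
    using f unfolding Linf_def by blast
  have "integrable (lebesgue_on I) (\<lambda>x. C * h x)" using h by simp
  then show ?thesis
  proof (rule Bochner_Integration.integrable_bound)
    show "(\<lambda>x. f x * h x) \<in> borel_measurable (lebesgue_on I)" using h by measurable
    from C show "AE x in lebesgue_on I. norm (f x * h x) \<le> norm (C * h x)"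
      by eventually_elim (auto simp: abs_mult intro!: mult_right_mono)
  qed
qed

section \<open>Sublevels of supremal functionals\<close>

lemma density_measurable:
  fixes g :: "real \<Rightarrow> real"
  assumes "f \<in> borel_measurable (borel :: (real \<times> real) measure)"
    and "g \<in> borel_measurable (lebesgue_on {a<..<b})"
  shows "(\<lambda>(x, y). ereal (f (g x, g y))) \<in> borel_measurable (lebesgue_on ({a<..<b} \<times> {a<..<b}))"
  using measurable_compose[OF coordinates_measurable[OF assms(2)] assms(1)]
  by (simp add: case_prod_beta)

lemma esssup_le_iff:
  assumes "f \<in> borel_measurable M"
  shows "esssup M f \<le> c \<longleftrightarrow> (AE x in M. f x \<le> c)"
proof
  assume "esssup M f \<le> c"
  then show "AE x in M. f x \<le> c"
    using esssup_AE[of f M] by (auto elim: eventually_mono intro: order_trans)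
qed (use assms in \<open>rule esssup_I\<close>)

text \<open>The common description of the sublevels of both functionals: \<open>g\<close> is the derivative, and the
  density enters only through the corner of one square that contains almost every pair of values.\<close>

definition range_in_square :: "real set \<Rightarrow> (real \<times> real \<Rightarrow> real) \<Rightarrow> (real \<Rightarrow> real) \<Rightarrow> real \<Rightarrow> bool" where
  "range_in_square I V g c \<longleftrightarrow>
     (\<exists>\<alpha> \<beta>. V (\<alpha>, \<beta>) \<le> c \<and> (AE x in lebesgue_on I. g x \<in> {\<alpha>..\<beta>}))"

lemma AE_lebesgue_on_interval_nontrivial:
  assumes "a < (b::real)"
  shows "\<not> (AE x in lebesgue_on {a<..<b}. False)"
proof
  assume "AE x in lebesgue_on {a<..<b}. False"
  then have "emeasure (lebesgue_on {a<..<b}) (space (lebesgue_on {a<..<b})) = 0"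
    unfolding ae_filter_eq_bot_iff[symmetric] trivial_limit_def .
  then show False using assms by (simp add: emeasure_restrict_space)
qed

text \<open>Almost every pair of values of \<open>g\<close> lies in some square, which may depend on the pair. Pairs with
  one value near the essential infimum and the other near the essential supremum force squares that
  almost contain the whole range; compactness gives one square that contains it.\<close>

lemma AE_in_square_imp_range_in_square:
  assumes V: "coercive V" "lower_semicontinuous V" and ab: "a < b"
    and g: "g \<in> Linf {a<..<b}"
    and ae: "AE p in lebesgue_on ({a<..<b} \<times> {a<..<b}). in_square V c (g (fst p), g (snd p))"
  shows "range_in_square {a<..<b} V g c"
proof -
  let ?M = "lebesgue_on {a<..<b}"
  obtain C where C: "AE x in ?M. \<bar>g x\<bar> \<le> C" using g unfolding Linf_def by blast
  obtain m where m: "AE x in ?M. m \<le> g x" "\<And>t. m < t \<Longrightarrow> \<not> (AE x in ?M. t \<le> g x)"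
    using essential_lower_bound[OF C AE_lebesgue_on_interval_nontrivial[OF ab]] by blast
  have "AE x in ?M. \<bar>- g x\<bar> \<le> C" using C by simp
  then obtain m' where m': "AE x in ?M. m' \<le> - g x" "\<And>t. m' < t \<Longrightarrow> \<not> (AE x in ?M. t \<le> - g x)"
    using essential_lower_bound[OF _ AE_lebesgue_on_interval_nontrivial[OF ab]] by metis
  have sec: "AE x in ?M. AE y in ?M. in_square V c (g x, g y)"
    using AE_lebesgue_plane_sections[OF _ ae] interval_square_lebesgue by simp
  have "\<exists>q. V q \<le> c \<and> fst q < m + 1 / Suc n \<and> - m' - 1 / Suc n < snd q" for n
  proof -
    have "\<exists>x. (AE y in ?M. in_square V c (g x, g y)) \<and> g x < m + 1 / Suc n"
    proof (rule ccontr)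
      assume no: "\<not> ?thesis"
      from sec have "AE x in ?M. m + 1 / Suc n \<le> g x"
        by eventually_elim (use no in force)
      with m(2)[of "m + 1 / Suc n"] show False by simp
    qed
    then obtain x where x: "AE y in ?M. in_square V c (g x, g y)" "g x < m + 1 / Suc n"
      by blast
    have "\<exists>y. in_square V c (g x, g y) \<and> - m' - 1 / Suc n < g y"
    proof (rule ccontr)
      assume no: "\<not> ?thesis"
      from x(1) have "AE y in ?M. m' + 1 / Suc n \<le> - g y"
        by eventually_elim (use no in force)
      with m'(2)[of "m' + 1 / Suc n"] show False by simp
    qed
    then obtain y where y: "in_square V c (g x, g y)" "- m' - 1 / Suc n < g y"
      by blast
    from y(1) obtain \<alpha> \<beta> where "V (\<alpha>, \<beta>) \<le> c" "\<alpha> \<le> g x" "g y \<le> \<beta>"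
      unfolding in_square_def by auto
    with x y show ?thesis by (intro exI[of _ "(\<alpha>, \<beta>)"]) auto
  qed
  then obtain X where X: "\<And>n. V (X n) \<le> c" "\<And>n. fst (X n) < m + 1 / Suc n"
    "\<And>n. - m' - 1 / Suc n < snd (X n)"
    by metis
  obtain l r where lr: "strict_mono (r :: nat \<Rightarrow> nat)" "(X \<circ> r) \<longlonglongrightarrow> l" "V l \<le> c"
    by (rule coercive_lsc_compactness[OF V X(1) tendsto_const])
  have inv: "(\<lambda>n. 1 / real (Suc (r n))) \<longlonglongrightarrow> 0"
    using LIMSEQ_subseq_LIMSEQ[OF lim_1_over_n[THEN LIMSEQ_Suc] lr(1)] by (simp add: o_def)
  have "fst l \<le> m + 0"
    by (rule LIMSEQ_le[OF tendsto_fst[OF lr(2)] tendsto_add[OF tendsto_const inv]])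
      (use X(2) in \<open>auto intro!: exI[of _ 0] less_imp_le\<close>)
  moreover have "- m' - 0 \<le> snd l"
    by (rule LIMSEQ_le[OF tendsto_diff[OF tendsto_const inv] tendsto_snd[OF lr(2)]])
      (use X(3) in \<open>auto intro!: exI[of _ 0] less_imp_le\<close>)
  ultimately have l: "fst l \<le> m" "- m' \<le> snd l" by simp_all
  from m(1) m'(1) have "AE x in ?M. g x \<in> {fst l..snd l}"
    by eventually_elim (use l in auto)
  then show ?thesis
    unfolding range_in_square_def using lr(3) by (metis prod.collapse)
qed

lemma esssup_slc_envelope_le_iff:
  assumes V: "coercive V" "lower_semicontinuous V" "diagonal_density V" "symmetric_density V"
    and ab: "a < b" and g: "g \<in> Linf {a<..<b}"
  shows "esssup (lebesgue_on ({a<..<b} \<times> {a<..<b})) (\<lambda>(x, y). ereal (slc_envelope V (g x, g y)))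
      \<le> ereal c \<longleftrightarrow> range_in_square {a<..<b} V g c"
proof -
  have gm: "g \<in> borel_measurable (lebesgue_on {a<..<b})" using g unfolding Linf_def by blast
  show ?thesis
    unfolding esssup_le_iff[OF density_measurable[OF slc_envelope_borel[OF V] gm]]
      case_prod_beta ereal_less_eq slc_envelope_le_iff[OF V]
  proof
    assume "range_in_square {a<..<b} V g c"
    then obtain \<alpha> \<beta> where \<alpha>\<beta>: "V (\<alpha>, \<beta>) \<le> c" "AE x in lebesgue_on {a<..<b}. g x \<in> {\<alpha>..\<beta>}"
      unfolding range_in_square_def by blast
    have "AE p in lebesgue_on ({a<..<b} \<times> {a<..<b}). g (fst p) \<in> {\<alpha>..\<beta>} \<and> g (snd p) \<in> {\<alpha>..\<beta>}"
      by (rule AE_lebesgue_plane_coordinates[OF _ \<alpha>\<beta>(2) interval_square_lebesgue]) simp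
    then show "AE p in lebesgue_on ({a<..<b} \<times> {a<..<b}). in_square V c (g (fst p), g (snd p))"
    proof eventually_elim
      case (elim p)
      with \<alpha>\<beta>(1) show ?case unfolding in_square_def by auto
    qed
  qed (rule AE_in_square_imp_range_in_square[OF V(1,2) ab g])
qed

text \<open>An upper bound survives weak* convergence: testing with the indicator of \<open>{g > \<beta>'}\<close> shows that
  \<open>g - \<beta>'\<close> has nonpositive integral over the set where it is positive.\<close>

lemma weakstar_limit_upper_bound:
  assumes I: "I \<in> lmeasurable" and f: "\<And>j. f j \<in> Linf I" and g: "g \<in> Linf I"
    and ws: "weakstar_Linf I f g"
    and r: "strict_mono r" and le: "\<And>n. AE x in lebesgue_on I. f (r n) x \<le> \<beta> n"
    and \<beta>: "\<beta> \<longlonglongrightarrow> \<beta>'"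
  shows "AE x in lebesgue_on I. g x \<le> \<beta>'"
proof -
  let ?M = "lebesgue_on I"
  interpret finite_measure ?M by (rule finite_measure_lebesgue_on[OF I])
  note int = Linf_integrable[OF _ I]
  have gm[measurable]: "g \<in> borel_measurable ?M" using g unfolding Linf_def by blast
  define E where "E = {x \<in> space ?M. \<beta>' < g x}"
  have E[measurable]: "E \<in> sets ?M" unfolding E_def by measurable
  define h where "h = (indicator E :: real \<Rightarrow> real)"
  have h: "integrable ?M h" unfolding h_def by (auto simp: emeasure_eq_measure)
  have prod: "integrable ?M (\<lambda>x. f x * h x)" if "f \<in> Linf I" for f
    unfolding h_def using integrable_mult_indicator[OF E int[OF that]] by (simp add: mult.commute)
  have "(\<lambda>n. LINT x|?M. f (r n) x * h x) \<longlonglongrightarrow> (LINT x|?M. g x * h x)"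
    using LIMSEQ_subseq_LIMSEQ[OF ws[unfolded weakstar_Linf_def, rule_format, OF h] r]
    by (simp add: o_def)
  moreover have "(\<lambda>n. \<beta> n * (LINT x|?M. h x)) \<longlonglongrightarrow> \<beta>' * (LINT x|?M. h x)"
    by (intro tendsto_mult \<beta> tendsto_const)
  moreover have "(LINT x|?M. f (r n) x * h x) \<le> \<beta> n * (LINT x|?M. h x)" for n
  proof -
    have "(LINT x|?M. f (r n) x * h x) \<le> (LINT x|?M. \<beta> n * h x)"
    proof (rule integral_mono_AE[OF prod[OF f]])
      from le[of n] show "AE x in ?M. f (r n) x * h x \<le> \<beta> n * h x"
        by eventually_elim (auto simp: h_def indicator_def)
    qed (use h in simp)
    then show ?thesis by simp
  qed
  ultimately have "(LINT x|?M. g x * h x) \<le> \<beta>' * (LINT x|?M. h x)"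
    by (intro LIMSEQ_le) auto
  then have le0: "(LINT x|?M. (g x - \<beta>') * h x) \<le> 0"
    using prod[OF g] h by (simp add: left_diff_distrib)
  have nn: "0 \<le> (g x - \<beta>') * h x" for x
    unfolding h_def E_def by (auto simp: indicator_def)
  have "integrable ?M (\<lambda>x. (g x - \<beta>') * h x)"
    using prod[OF g] h by (simp add: left_diff_distrib)
  from integral_nonneg_eq_0_iff_AE[OF this] have "AE x in ?M. (g x - \<beta>') * h x = 0"
    using le0 nn Bochner_Integration.integral_nonneg[of ?M "\<lambda>x. (g x - \<beta>') * h x"] by (simp add: antisym)
  then show ?thesis
    using AE_space[of ?M] by eventually_elim (auto simp: h_def E_def indicator_def split: if_splits)
qed

lemma weakstar_Linf_uminus:
  "weakstar_Linf I f g \<Longrightarrow> weakstar_Linf I (\<lambda>j x. - f j x) (\<lambda>x. - g x)"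
  unfolding weakstar_Linf_def by (auto intro!: tendsto_minus)

text \<open>It suffices that infinitely many members of the sequence satisfy the bound, which is all that a
  bound on the lower limit of the functionals provides.\<close>

lemma weakstar_limit_range_in_square:
  assumes V: "coercive V" "lower_semicontinuous V"
    and I: "I \<in> lmeasurable" and f: "\<And>j. f j \<in> Linf I" and g: "g \<in> Linf I"
    and ws: "weakstar_Linf I f g"
    and sq: "\<exists>\<^sub>F j in sequentially. range_in_square I V (f j) c"
  shows "range_in_square I V g c"
proof -
  obtain r where r: "strict_mono (r :: nat \<Rightarrow> nat)" "\<And>n. range_in_square I V (f (r n)) c"
  proof -
    have "infinite {j. range_in_square I V (f j) c}"
      using sq by (simp add: cofinite_eq_sequentially[symmetric] frequently_cofinite)
    from infinite_enumerate[OF this] that show ?thesis by blast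
  qed
  then have "\<exists>q. V q \<le> c \<and> (AE x in lebesgue_on I. f (r n) x \<in> {fst q..snd q})" for n
    unfolding range_in_square_def by force
  then obtain X where X: "\<And>n. V (X n) \<le> c"
    "\<And>n. AE x in lebesgue_on I. f (r n) x \<in> {fst (X n)..snd (X n)}"
    by metis
  obtain l s where ls: "strict_mono (s :: nat \<Rightarrow> nat)" "(X \<circ> s) \<longlonglongrightarrow> l" "V l \<le> c"
    by (rule coercive_lsc_compactness[OF V X(1) tendsto_const])
  have rs: "strict_mono (r \<circ> s)" using r(1) ls(1) by (rule strict_mono_o)
  have up: "AE x in lebesgue_on I. g x \<le> snd l"
    by (rule weakstar_limit_upper_bound[OF I f g ws rs _ tendsto_snd[OF ls(2)]])
      (use X(2) in \<open>auto elim: eventually_mono\<close>)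
  have neg: "(\<lambda>x. - h x) \<in> Linf I" if "h \<in> Linf I" for h
    using that unfolding Linf_def by auto
  have "AE x in lebesgue_on I. - g x \<le> - fst l"
    by (rule weakstar_limit_upper_bound[OF I neg[OF f] neg[OF g] weakstar_Linf_uminus[OF ws] rs _
          tendsto_minus[OF tendsto_fst[OF ls(2)]]])
      (use X(2) in \<open>auto elim: eventually_mono\<close>)
  with up have "AE x in lebesgue_on I. g x \<in> {fst l..snd l}"
    by eventually_elim auto
  then show ?thesis
    unfolding range_in_square_def using ls(3) by (metis prod.collapse)
qed

text \<open>Needed because the infimum in the relaxed functional, and the lower limit inside it, give the
  bound only at levels above \<open>c\<close>.\<close>

lemma range_in_square_from_above:
  assumes V: "coercive V" "lower_semicontinuous V"
    and sq: "\<And>c'. c < c' \<Longrightarrow> range_in_square I V g c'"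
  shows "range_in_square I V g c"
proof -
  have "\<exists>q. V q \<le> c + 1 / Suc n \<and> (AE x in lebesgue_on I. g x \<in> {fst q..snd q})" for n
    using sq[of "c + 1 / Suc n"] unfolding range_in_square_def by force
  then obtain X where X: "\<And>n. V (X n) \<le> c + 1 / Suc n"
    "\<And>n. AE x in lebesgue_on I. g x \<in> {fst (X n)..snd (X n)}"
    by metis
  have "(\<lambda>n. c + 1 / Suc n) \<longlonglongrightarrow> c"
    using tendsto_add[OF tendsto_const lim_1_over_n[THEN LIMSEQ_Suc], of c] by simp
  then obtain l r where lr: "strict_mono (r :: nat \<Rightarrow> nat)" "(X \<circ> r) \<longlonglongrightarrow> l" "V l \<le> c"
    by (rule coercive_lsc_compactness[OF V X(1)])
  have "AE x in lebesgue_on I. \<forall>n. g x \<in> {fst (X n)..snd (X n)}"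
    using X(2) by (simp only: AE_all_countable) simp
  then have "AE x in lebesgue_on I. g x \<in> {fst l..snd l}"
  proof eventually_elim
    case (elim x)
    then have "fst ((X \<circ> r) n) \<le> g x" "g x \<le> snd ((X \<circ> r) n)" for n by simp_all
    then show ?case
      using LIMSEQ_le_const2[OF tendsto_fst[OF lr(2)]] LIMSEQ_le_const[OF tendsto_snd[OF lr(2)]]
      by (metis atLeastAtMost_iff)
  qed
  then show ?thesis
    unfolding range_in_square_def using lr(3) by (metis prod.collapse)
qed

lemma J1d_le_imp_range_in_square:
  assumes V: "coercive V" "lower_semicontinuous V" "diagonal_density V" "symmetric_density V"
    and ab: "a < b" and g: "wderiv {a<..<b} u \<in> Linf {a<..<b}"
    and J: "J1d {a<..<b} V u \<le> ereal c"
  shows "range_in_square {a<..<b} V (wderiv {a<..<b} u) c"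
proof -
  let ?M = "lebesgue_on ({a<..<b} \<times> {a<..<b})"
  let ?g = "wderiv {a<..<b} u"
  have "AE p in ?M. V (?g (fst p), ?g (snd p)) \<le> c"
    using J g esssup_le_iff[OF density_measurable[OF lower_semicontinuous_borel[OF V(2)]], of ?g]
    unfolding J1d_def Linf_def by (simp add: case_prod_beta)
  then have "AE p in ?M. in_square V c (?g (fst p), ?g (snd p))"
  proof eventually_elim
    case (elim p)
    have "slc_envelope V (?g (fst p), ?g (snd p)) \<le> V (?g (fst p), ?g (snd p))"
      using slc_envelope_greatest(2)[of 0 V, OF coercive_nonneg[OF V(1)]] by (rule le_funD)
    with elim show ?case using slc_envelope_le_iff[OF V] by (meson order_trans)
  qed
  then show ?thesis
    by (rule AE_in_square_imp_range_in_square[OF V(1,2) ab g])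
qed

lemma range_in_vertices_imp_J1d_le:
  assumes V: "lower_semicontinuous V" "diagonal_density V" "symmetric_density V"
    and g: "wderiv {a<..<b} u \<in> Linf {a<..<b}"
    and c: "V (\<alpha>, \<beta>) \<le> c" and ae: "AE x in lebesgue_on {a<..<b}. wderiv {a<..<b} u x \<in> {\<alpha>, \<beta>}"
  shows "J1d {a<..<b} V u \<le> ereal c"
proof -
  let ?M = "lebesgue_on ({a<..<b} \<times> {a<..<b})"
  let ?g = "wderiv {a<..<b} u"
  have "AE p in ?M. ?g (fst p) \<in> {\<alpha>, \<beta>} \<and> ?g (snd p) \<in> {\<alpha>, \<beta>}"
    by (rule AE_lebesgue_plane_coordinates[OF _ ae interval_square_lebesgue]) simp
  then have "AE p in ?M. V (?g (fst p), ?g (snd p)) \<le> c"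
    by eventually_elim (rule vertices_in_level_set[OF V(2,3) c], auto)
  then show ?thesis
    using g esssup_le_iff[OF density_measurable[OF lower_semicontinuous_borel[OF V(1)]], of ?g]
    unfolding J1d_def Linf_def by (simp add: case_prod_beta)
qed

lemma wderiv_W1inf:
  assumes "u \<in> W1inf I"
  shows "wderiv I u \<in> Linf I" "weak_deriv I u (wderiv I u)"
  using assms someI_ex[of "\<lambda>g. g \<in> Linf I \<and> weak_deriv I u g"]
  unfolding W1inf_def wderiv_def by auto

text \<open>The lower bound of the relaxation. Each function with \<open>J1d\<close> at most \<open>c'\<close> has its derivative in
  one square of level \<open>c'\<close>, and this constraint is closed under weak* convergence.\<close>

lemma J1d_rlx_le_imp_range_in_square:
  assumes V: "coercive V" "lower_semicontinuous V" "diagonal_density V" "symmetric_density V"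
    and ab: "a < b" and u: "u \<in> W1inf {a<..<b}"
    and J: "J1d_rlx {a<..<b} V u \<le> ereal c"
  shows "range_in_square {a<..<b} V (wderiv {a<..<b} u) c"
proof (rule range_in_square_from_above[OF V(1,2)])
  fix c' assume "c < c'"
  then have "J1d_rlx {a<..<b} V u < ereal c'"
    using J by (auto intro: le_less_trans)
  then obtain v where v: "\<And>j. v j \<in> W1inf {a<..<b}" "weakstar_W1inf {a<..<b} v u"
    "liminf (\<lambda>j. J1d {a<..<b} V (v j)) < ereal c'"
    unfolding J1d_rlx_def Inf_less_iff by blast
  have "\<not> (\<forall>\<^sub>F j in sequentially. ereal c' \<le> J1d {a<..<b} V (v j))"
  proof
    assume "\<forall>\<^sub>F j in sequentially. ereal c' \<le> J1d {a<..<b} V (v j)"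
    from Liminf_bounded[OF this] v(3) show False by simp
  qed
  then have "\<exists>\<^sub>F j in sequentially. J1d {a<..<b} V (v j) \<le> ereal c'"
    unfolding not_eventually by (rule frequently_elim1) simp
  then have "\<exists>\<^sub>F j in sequentially. range_in_square {a<..<b} V (wderiv {a<..<b} (v j)) c'"
    by (rule frequently_elim1)
      (rule J1d_le_imp_range_in_square[OF V ab wderiv_W1inf(1)[OF v(1)]])
  then show "range_in_square {a<..<b} V (wderiv {a<..<b} u) c'"
    using v(2) unfolding weakstar_W1inf_def
    by (intro weakstar_limit_range_in_square[OF V(1,2) _ wderiv_W1inf(1)[OF v(1)]
          wderiv_W1inf(1)[OF u]]) auto
qed

section \<open>Smooth bumps\<close>

text \<open>With \<open>p = 1\<close> and \<open>k = 0\<close> this is the classical bump \<open>exp (- e / ((x - c) (d - x)))\<close> on \<open>(c, d)\<close>.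
  The polynomial and the power of the denominator make the family closed under differentiation, so
  that smoothness follows from a first-order computation. The parameter \<open>e\<close> lets the bump tend to the
  indicator of the interval.\<close>

definition bump :: "real \<Rightarrow> real \<Rightarrow> real \<Rightarrow> real poly \<Rightarrow> nat \<Rightarrow> real \<Rightarrow> real" where
  "bump e c d p k x =
     (if x \<in> {c<..<d} then poly p x / ((x - c) * (d - x)) ^ k * exp (- e / ((x - c) * (d - x))) else 0)"

text \<open>A single term of the exponential series; it makes \<open>exp (- e / q)\<close> beat any power of \<open>q\<close>.\<close>

lemma power_over_fact_le_exp:
  assumes "0 \<le> (x::real)"
  shows "x ^ n / fact n \<le> exp x"
proof -
  have "(\<Sum>i\<in>{n}. x ^ i /\<^sub>R fact i) \<le> exp x"
    unfolding exp_def using assms by (intro sum_le_suminf summable_exp_generic) auto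
  then show ?thesis by (simp add: divide_inverse mult.commute)
qed

text \<open>One estimate covers both endpoints and all points outside: the product \<open>q = (x - c) (d - x)\<close> is at
  most \<open>(d - c) \<bar>x - x0\<bar>\<close> for \<open>x\<close> inside \<open>(c, d)\<close> and \<open>x0\<close> outside, and
  \<open>exp (- e / q)\<close> is at most a constant times \<open>q ^ (k + 2)\<close>.\<close>

lemma bump_quadratic_decay:
  assumes e: "0 < e"
  obtains K where "\<And>x0 x. x0 \<notin> {c<..<d} \<Longrightarrow> \<bar>bump e c d p k x\<bar> \<le> K * (x - x0)\<^sup>2"
proof -
  have "compact (poly p ` {c..d})"
    by (intro compact_continuous_image compact_Icc continuous_intros)
  then have "bounded (poly p ` {c..d})" by (rule compact_imp_bounded)
  then obtain B where "\<forall>y\<in>poly p ` {c..d}. norm y \<le> B"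
    unfolding bounded_iff by blast
  then have B: "\<bar>poly p x\<bar> \<le> B" if "x \<in> {c..d}" for x
    using that by simp
  define D where "D = \<bar>B\<bar> * fact (k + 2) / e ^ (k + 2)"
  have D: "0 \<le> D" unfolding D_def using e by simp
  have "\<bar>bump e c d p k x\<bar> \<le> D * (d - c)\<^sup>2 * (x - x0)\<^sup>2" if x0: "x0 \<notin> {c<..<d}" for x0 x
  proof (cases "x \<in> {c<..<d}")
    case True
    define q where "q = (x - c) * (d - x)"
    have q: "0 < q" unfolding q_def using True by simp
    have "(e / q) ^ (k + 2) / fact (k + 2) \<le> exp (e / q)"
      using q e by (intro power_over_fact_le_exp) simp
    then have "exp (- (e / q)) \<le> fact (k + 2) * q ^ (k + 2) / e ^ (k + 2)"
      using q e by (simp add: exp_minus field_simps power_divide del: power_Suc fact_Suc add_2_eq_Suc' )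
    then have "exp (- e / q) / q ^ k \<le> fact (k + 2) / e ^ (k + 2) * q\<^sup>2"
      using q by (simp add: field_simps power_add power2_eq_square del: fact_Suc add_2_eq_Suc')
    then have "\<bar>poly p x\<bar> * (exp (- e / q) / q ^ k) \<le> \<bar>B\<bar> * (fact (k + 2) / e ^ (k + 2) * q\<^sup>2)"
      using B[of x] True q by (intro mult_mono) auto
    then have 1: "\<bar>bump e c d p k x\<bar> \<le> D * q\<^sup>2"
      using True q unfolding bump_def D_def q_def[symmetric] by (simp add: abs_mult field_simps)
    have "q \<le> (d - c) * \<bar>x - x0\<bar>"
    proof (cases "x0 \<le> c")
      case True
      have "(x - c) * (d - x) \<le> (x - x0) * (d - c)"
        using True \<open>x \<in> {c<..<d}\<close> by (intro mult_mono) auto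
      then show ?thesis using True \<open>x \<in> {c<..<d}\<close> by (simp add: q_def mult.commute)
    next
      case False
      then have "d \<le> x0" using x0 by auto
      then have "(x - c) * (d - x) \<le> (d - c) * (x0 - x)"
        using \<open>x \<in> {c<..<d}\<close> by (intro mult_mono) auto
      then show ?thesis using \<open>d \<le> x0\<close> \<open>x \<in> {c<..<d}\<close> by (simp add: q_def)
    qed
    then have "q\<^sup>2 \<le> (d - c)\<^sup>2 * (x - x0)\<^sup>2"
      using q power_mono[of q "(d - c) * \<bar>x - x0\<bar>" 2] by (simp add: power_mult_distrib)
    then have "D * q\<^sup>2 \<le> D * ((d - c)\<^sup>2 * (x - x0)\<^sup>2)" by (intro mult_left_mono D)
    with 1 show ?thesis by (simp add: mult.assoc)
  next
    case False
    then have "bump e c d p k x = 0" by (simp only: bump_def if_False)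
    then show ?thesis using D by simp
  qed
  then show ?thesis using that by blast
qed

lemma quadratic_decay_deriv:
  fixes f :: "real \<Rightarrow> real"
  assumes f: "\<And>x. \<bar>f x\<bar> \<le> K * (x - x0)\<^sup>2"
  shows "(f has_real_derivative 0) (at x0)"
  unfolding DERIV_def
proof (rule Lim_null_comparison)
  have f0: "f x0 = 0" using f[of x0] by simp
  show "\<forall>\<^sub>F h in at 0. norm ((f (x0 + h) - f x0) / h) \<le> K * \<bar>h\<bar>"
    using eventually_neq_at_within[of 0]
  proof eventually_elim
    case (elim h)
    have "\<bar>f (x0 + h)\<bar> \<le> K * \<bar>h\<bar> * \<bar>h\<bar>" using f[of "x0 + h"] by (simp add: power2_eq_square)
    with elim show ?case by (simp add: f0 field_simps)
  qed
  show "((\<lambda>h. K * \<bar>h\<bar>) \<longlongrightarrow> 0) (at 0)"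
    by (rule tendsto_eq_intros refl | simp)+
qed

lemma bump_deriv:
  assumes e: "0 < e"
  obtains p' k' where "\<And>x. (bump e c d p k has_real_derivative bump e c d p' k' x) (at x)"
proof -
  define Q where "Q = [:-c, 1:] * [:d, -1:]"
  have Q: "poly Q x = (x - c) * (d - x)" for x by (simp add: Q_def algebra_simps)
  \<comment> \<open>The numerator of the derivative of \<open>p / Q ^ k * exp (- e / Q)\<close> over the denominator
    \<open>Q ^ (k + 2)\<close>.\<close>
  define p' where "p' = pderiv p * Q ^ 2 - smult (of_nat k) (p * pderiv Q * Q) + smult e (p * pderiv Q)"
  have "(bump e c d p k has_real_derivative bump e c d p' (k + 2) x) (at x)" for x
  proof (cases "x \<in> {c<..<d}")
    case False
    obtain K where "\<And>x0 x. x0 \<notin> {c<..<d} \<Longrightarrow> \<bar>bump e c d p k x\<bar> \<le> K * (x - x0)\<^sup>2"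
      using bump_quadratic_decay[OF e] by blast
    from quadratic_decay_deriv[OF this[OF False]]
    have "(bump e c d p k has_real_derivative 0) (at x)" .
    moreover have "bump e c d p' (k + 2) x = 0" using False by (simp only: bump_def if_False)
    ultimately show ?thesis by simp
  next
    case True
    then have q: "poly Q x > 0" unfolding Q by simp
    have "bump e c d p' (k + 2) x = poly p' x / poly Q x ^ (k + 2) * exp (- e / poly Q x)"
      unfolding bump_def Q using True by (simp only: if_True)
    moreover have "((\<lambda>x. poly p x / poly Q x ^ k * exp (- e / poly Q x)) has_real_derivative
        poly p' x / poly Q x ^ (k + 2) * exp (- e / poly Q x)) (at x)"
    proof -
      have pow: "poly Q x * poly Q x ^ (k - Suc 0) = poly Q x ^ k" if "k > 0"
        using that by (cases k) auto
      show ?thesis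
        using q pow unfolding p'_def
        by (cases "k = 0") (auto intro!: derivative_eq_intros simp: field_simps power2_eq_square)
    qed
    ultimately have "((\<lambda>x. poly p x / poly Q x ^ k * exp (- e / poly Q x)) has_real_derivative
        bump e c d p' (k + 2) x) (at x)" by simp
    moreover have "open {c<..<d}" by simp
    ultimately show ?thesis
      by (rule has_field_derivative_transform_within_open[OF _ _ True]) (simp add: bump_def Q)
  qed
  then show ?thesis using that by blast
qed

lemma bump_iterated_deriv:
  assumes e: "0 < e"
  shows "\<exists>p' k'. (deriv ^^ n) (bump e c d p k) = bump e c d p' k'"
proof (induction n)
  case (Suc n)
  then obtain p' k' where *: "(deriv ^^ n) (bump e c d p k) = bump e c d p' k'" by blast
  obtain p'' k'' where "\<And>x. (bump e c d p' k' has_real_derivative bump e c d p'' k'' x) (at x)"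
    using bump_deriv[OF e] by blast
  then have "deriv (bump e c d p' k') = bump e c d p'' k''"
    by (intro ext DERIV_imp_deriv)
  then show ?case using * by auto
qed auto

lemma bump_test_function:
  assumes e: "0 < e" and I: "{c..d} \<subseteq> I"
  shows "bump e c d p k \<in> test_functions I"
proof -
  have "(deriv ^^ n) (bump e c d p k) differentiable (at x)" for n x
    using bump_iterated_deriv[OF e, of n c d p k] bump_deriv[OF e]
    by (metis real_differentiable_def)
  moreover have supp: "closure {x. bump e c d p k x \<noteq> 0} \<subseteq> {c..d}"
    by (rule closure_minimal) (auto simp: bump_def split: if_splits)
  moreover have "compact (closure {x. bump e c d p k x \<noteq> 0})"
    using supp by (meson bounded_closed_interval bounded_subset closed_closure compact_eq_bounded_closed)
  ultimately show ?thesis using I unfolding test_functions_def by blast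
qed

section \<open>Weak-star convergence from primitives\<close>

text \<open>Reduces indicators of Lebesgue sets to indicators of Borel sets, for which an induction over a
  generator is available.\<close>

lemma borel_indicator_AE:
  assumes "A \<in> sets (lebesgue_on I)" "I \<in> sets lebesgue"
  obtains S where "S \<in> sets borel" "AE x in lebesgue_on I. indicator A x = (indicator S x :: real)"
proof -
  have "A \<in> sets lebesgue" using assms by (auto simp: sets_restrict_space)
  then obtain S N N' where S: "A = S \<union> N" "N \<subseteq> N'" "N' \<in> null_sets lborel" "S \<in> sets lborel"
    by (elim sets_completionE)
  have "AE x in lborel. x \<notin> N'" using S(3) by (rule AE_not_in)
  then have "AE x in lebesgue. x \<notin> N'" by (rule AE_completion)
  then have "AE x in lebesgue. x \<in> I \<longrightarrow> x \<notin> N'" by auto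
  then have "AE x in lebesgue_on I. x \<notin> N'"
    using assms(2) by (simp add: AE_restrict_space_iff)
  then have "AE x in lebesgue_on I. indicator A x = (indicator S x :: real)"
    by eventually_elim (use S in \<open>auto simp: indicator_def\<close>)
  then show ?thesis using that S(4) by simp
qed

text \<open>For a bounded sequence, convergence of the primitives to 0 is weak* convergence to 0. The
  functions \<open>h\<close> against which the integrals tend to 0 are closed under linear combinations and, by the
  uniform bound, under \<open>L\<^sup>1\<close> limits. Half-lines generate the Borel sets as a \<pi>-system, so the class
  contains all Borel indicators, and then all integrable functions.\<close>

lemma weakstar_null_from_primitives:
  fixes k :: "nat \<Rightarrow> real \<Rightarrow> real" and a b :: real
  defines "M \<equiv> lebesgue_on {a<..<b}"
  assumes k[measurable]: "\<And>n. k n \<in> borel_measurable M" and bdd: "\<And>n. AE x in M. \<bar>k n x\<bar> \<le> B"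
    and prim: "\<And>x. (\<lambda>n. LINT t|M. k n t * indicator {..x} t) \<longlonglongrightarrow> 0"
    and h: "integrable M h"
  shows "(\<lambda>n. LINT t|M. k n t * h t) \<longlonglongrightarrow> 0"
proof -
  interpret finite_measure M unfolding M_def by (rule finite_measure_lebesgue_on) simp
  define P where "P h \<longleftrightarrow> (\<lambda>n. LINT t|M. k n t * h t) \<longlonglongrightarrow> 0" for h
  have int: "integrable M (\<lambda>t. k n t * h t)" if h: "integrable M h" for n h
  proof (rule Bochner_Integration.integrable_bound)
    show "integrable M (\<lambda>t. B * h t)" using h by simp
    show "(\<lambda>t. k n t * h t) \<in> borel_measurable M" using h by measurable
    from bdd[of n] show "AE t in M. norm (k n t * h t) \<le> norm (B * h t)"
      by eventually_elim (auto simp: abs_mult intro!: mult_right_mono)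
  qed
  have bound: "\<bar>LINT t|M. k n t * h t\<bar> \<le> B * (LINT t|M. \<bar>h t\<bar>)" if h: "integrable M h" for n h
  proof -
    have "\<bar>LINT t|M. k n t * h t\<bar> \<le> (LINT t|M. \<bar>k n t * h t\<bar>)"
      by (rule integral_abs_bound)
    also have "\<dots> \<le> (LINT t|M. B * \<bar>h t\<bar>)"
    proof (rule integral_mono_AE)
      from bdd[of n] show "AE t in M. \<bar>k n t * h t\<bar> \<le> B * \<bar>h t\<bar>"
        by eventually_elim (auto simp: abs_mult intro!: mult_right_mono)
    qed (use int[OF h] h in auto)
    finally show ?thesis by simp
  qed
  have lim_P: "P f" if s: "\<And>i. integrable M (s i)" "\<And>i. P (s i)" and f: "integrable M f"
    and L1: "(\<lambda>i. LINT t|M. \<bar>f t - s i t\<bar>) \<longlonglongrightarrow> 0" for f s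
    unfolding P_def
  proof (rule LIMSEQ_I)
    fix \<epsilon> :: real assume \<epsilon>: "0 < \<epsilon>"
    have "(\<lambda>i. B * (LINT t|M. \<bar>f t - s i t\<bar>)) \<longlonglongrightarrow> B * 0"
      by (intro tendsto_mult tendsto_const L1)
    then have "\<forall>\<^sub>F i in sequentially. B * (LINT t|M. \<bar>f t - s i t\<bar>) < \<epsilon> / 2"
      using \<epsilon> by (intro order_tendstoD) auto
    then obtain i where i: "B * (LINT t|M. \<bar>f t - s i t\<bar>) < \<epsilon> / 2"
      by (auto simp: eventually_sequentially)
    obtain N where N: "\<And>n. n \<ge> N \<Longrightarrow> \<bar>LINT t|M. k n t * s i t\<bar> < \<epsilon> / 2"
      using LIMSEQ_D[OF s(2)[of i, unfolded P_def], of "\<epsilon> / 2"] \<epsilon> by auto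
    have "\<bar>LINT t|M. k n t * f t\<bar> < \<epsilon>" if "n \<ge> N" for n
    proof -
      have "(LINT t|M. k n t * f t) = (LINT t|M. k n t * s i t) + (LINT t|M. k n t * (f t - s i t))"
        using int[OF f] int[OF s(1)] by (simp add: right_diff_distrib)
      moreover have "\<bar>LINT t|M. k n t * (f t - s i t)\<bar> < \<epsilon> / 2"
        using bound[of "\<lambda>t. f t - s i t" n] f s(1) i by force
      ultimately show ?thesis using N[OF that] by linarith
    qed
    then show "\<exists>N. \<forall>n\<ge>N. norm ((LINT t|M. k n t * f t) - 0) < \<epsilon>" by auto
  qed
  have add_P: "P (\<lambda>t. f t + g t)" if "integrable M f" "integrable M g" "P f" "P g" for f g
    using tendsto_add[OF that(3,4)[unfolded P_def]] int[OF that(1)] int[OF that(2)]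
    unfolding P_def by (simp add: distrib_left)
  have smult_P: "P (\<lambda>t. c * f t)" if "P f" for f c
    using tendsto_mult_left[OF that[unfolded P_def], of c] unfolding P_def
    by (simp add: mult.left_commute)
  have cong: "P f \<longleftrightarrow> P g" if "integrable M f" "integrable M g" "AE t in M. f t = g t" for f g
  proof -
    have "(LINT t|M. k n t * f t) = (LINT t|M. k n t * g t)" for n
    proof (rule integral_cong_AE)
      from that(3) show "AE t in M. k n t * f t = k n t * g t" by eventually_elim simp
    qed (use that in measurable)
    then show ?thesis unfolding P_def by simp
  qed
  have borel[measurable]: "A \<in> sets M \<Longrightarrow> integrable M (indicator A :: real \<Rightarrow> real)" for A
    by (auto simp: emeasure_eq_measure)
  have int_borel: "integrable M (indicator A :: real \<Rightarrow> real)" if "A \<in> sets borel" for A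
  proof (rule integrable_const_bound[of _ 1])
    show "indicator A \<in> borel_measurable M"
      unfolding M_def using that by (intro measurable_restrict_space1 measurable_completion) auto
  qed (auto simp: indicator_def)
  have ind: "P (indicator A)" if "A \<in> sets borel" for A
  proof -
    have A: "A \<in> sigma_sets UNIV (range (\<lambda>x::real. {..x}))"
      using that by (simp add: borel_eq_atMost)
    have borelI: "A \<in> sigma_sets UNIV (range (\<lambda>x::real. {..x})) \<Longrightarrow> A \<in> sets borel" for A
      by (simp add: borel_eq_atMost)
    have stable: "Int_stable (range (\<lambda>x::real. {..x}))"
      by (auto simp: Int_stable_def)
    have closed: "range (\<lambda>x::real. {..x}) \<subseteq> Pow UNIV" by simp
    from stable closed A show ?thesis
    proof (induction rule: sigma_sets_induct_disjoint)
      case (basic A)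
      then show ?case using prim unfolding P_def by auto
    next
      case empty
      then show ?case unfolding P_def by simp
    next
      case (compl A)
      have "P (indicator {..b})" using prim unfolding P_def by auto
      then have "P (\<lambda>t. indicator {..b} t + (-1) * indicator A t)"
        using compl borelI[of A] by (intro add_P smult_P) (auto intro!: int_borel)
      moreover have "AE t in M. indicator {..b} t + (-1) * indicator A t = (indicator (UNIV - A) t :: real)"
        using AE_space by eventually_elim (auto simp: M_def indicator_def)
      ultimately show ?case
        using compl borelI[of A]
        by (subst (asm) cong) (auto intro!: int_borel Bochner_Integration.integrable_diff)
    next
      case (union A)
      have Ab: "A i \<in> sets borel" for i using union(2) borelI by blast
      define s where "s i = (\<lambda>t. \<Sum>j<i. indicator (A j) t :: real)" for i :: nat
      have s: "s i = indicator (\<Union>j<i. A j)" for i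
        unfolding s_def using union(1)
        by (intro ext indicator_UN_disjoint[symmetric]) (auto simp: disjoint_family_on_def)
      have s_int: "integrable M (s i)" for i
        unfolding s_def by (intro Bochner_Integration.integrable_sum int_borel Ab)
      have "P (s i)" for i
      proof (induction i)
        case (Suc i)
        have "P (\<lambda>t. s i t + indicator (A i) t)"
          by (rule add_P[OF s_int int_borel[OF Ab] Suc union(3)])
        then show ?case unfolding s_def by simp
      qed (simp add: s_def P_def)
      moreover have f_int: "integrable M (indicator (\<Union>i. A i) :: real \<Rightarrow> real)"
        using Ab by (intro int_borel) auto
      moreover have "(\<lambda>i. LINT t|M. \<bar>indicator (\<Union>i. A i) t - s i t\<bar>) \<longlonglongrightarrow> (LINT t|M. 0)"
      proof (rule integral_dominated_convergence[where w = "\<lambda>_. 1"])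
        have "(\<lambda>i. s i t) \<longlonglongrightarrow> indicator (\<Union>i. A i) t" for t
          unfolding s using LIMSEQ_indicator_UN[of A t, where 'a=real] by simp
        then have "(\<lambda>i. \<bar>indicator (\<Union>i. A i) t - s i t\<bar>) \<longlonglongrightarrow> \<bar>indicator (\<Union>i. A i) t - indicator (\<Union>i. A i) t\<bar>" for t
          by (intro tendsto_intros)
        then show "AE t in M. (\<lambda>i. \<bar>indicator (\<Union>i. A i) t - s i t\<bar>) \<longlonglongrightarrow> 0" by simp
        show "AE t in M. norm \<bar>indicator (\<Union>i. A i) t - s i t\<bar> \<le> 1" for i
          unfolding s by (auto simp: indicator_def)
        show "(\<lambda>t. \<bar>indicator (\<Union>i. A i) t - s i t\<bar>) \<in> borel_measurable M" for i
          using s_int[of i] f_int by measurable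
      qed auto
      ultimately show ?case using lim_P[OF s_int] by simp
    qed
  qed
  from h show ?thesis
    unfolding P_def[symmetric]
  proof (induct rule: integrable_induct)
    case (base A c)
    obtain S where S: "S \<in> sets borel" "AE x in M. indicator A x = (indicator S x :: real)"
      using borel_indicator_AE[of A "{a<..<b}"] base(1) unfolding M_def by auto
    have "P (indicator A)"
      using ind[OF S(1)] cong[OF borel[OF base(1)] int_borel[OF S(1)] S(2)] by simp
    from smult_P[OF this, of c] show ?case by (simp add: mult.commute)
  next
    case (add f g)
    then show ?case using add_P by blast
  next
    case (lim f s)
    have "(\<lambda>i. LINT t|M. \<bar>f t - s i t\<bar>) \<longlonglongrightarrow> (LINT t|M. 0)"
    proof (rule integral_dominated_convergence[where w = "\<lambda>t. 3 * \<bar>f t\<bar>"])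
      have "(\<lambda>i. \<bar>f t - s i t\<bar>) \<longlonglongrightarrow> \<bar>f t - f t\<bar>" if "t \<in> space M" for t
        by (intro tendsto_rabs tendsto_diff tendsto_const lim(3)[OF that])
      then show "AE t in M. (\<lambda>i. \<bar>f t - s i t\<bar>) \<longlonglongrightarrow> 0" by auto
      show "AE t in M. norm \<bar>f t - s i t\<bar> \<le> 3 * \<bar>f t\<bar>" for i
        using lim(4)[of _ i] by (intro AE_I2) (smt (verit) real_norm_def)
    qed (use lim(1,5) in auto)
    then have "(\<lambda>i. LINT t|M. \<bar>f t - s i t\<bar>) \<longlonglongrightarrow> 0" by simp
    from lim_P[OF lim(1,2,5) this] show ?case .
  qed
qed

section \<open>Uniqueness of weak derivatives\<close>

lemma test_function_deriv:
  assumes "\<phi> \<in> test_functions I"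
  shows "(\<phi> has_real_derivative deriv \<phi> x) (at x)" and "isCont (deriv \<phi>) x"
proof -
  have d: "(deriv ^^ n) \<phi> differentiable (at x)" for n
    using assms unfolding test_functions_def by blast
  show "(\<phi> has_real_derivative deriv \<phi> x) (at x)"
    using d[of 0] by (simp add: DERIV_deriv_iff_real_differentiable)
  show "isCont (deriv \<phi>) x"
    using differentiable_imp_continuous_within[OF d[of 1]] by simp
qed

lemma continuous_Linf:
  fixes f :: "real \<Rightarrow> real"
  assumes "\<And>x. isCont f x"
  shows "f \<in> Linf {a<..<b}"
proof -
  have c: "continuous_on S f" for S
    using assms by (simp add: continuous_at_imp_continuous_on)
  have "bounded (f ` {a..b})"
    using compact_continuous_image[OF c compact_Icc] by (rule compact_imp_bounded)
  then obtain B where "\<forall>y\<in>f ` {a..b}. norm y \<le> B" unfolding bounded_iff by blast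
  then have "AE x in lebesgue_on {a<..<b}. \<bar>f x\<bar> \<le> B" by (intro AE_I2) auto
  moreover have "f \<in> borel_measurable (lebesgue_on {a<..<b})"
    by (rule continuous_imp_measurable_on_sets_lebesgue[OF c]) simp
  ultimately show ?thesis unfolding Linf_def by blast
qed

lemma test_function_Linf:
  assumes "\<phi> \<in> test_functions I"
  shows "\<phi> \<in> Linf {a<..<b}" "deriv \<phi> \<in> Linf {a<..<b}"
  using DERIV_isCont[OF test_function_deriv(1)[OF assms]] test_function_deriv(2)[OF assms]
  by (auto intro: continuous_Linf)

lemma bump_le_1: "0 < e \<Longrightarrow> 0 \<le> bump e c d 1 0 x" "0 < e \<Longrightarrow> bump e c d 1 0 x \<le> 1"
  by (auto simp: bump_def)

text \<open>The bumps shrink slightly inside \<open>(a, y)\<close>, so that their supports stay compact in the interval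
  even when \<open>y\<close> is its right endpoint.\<close>

lemma bump_tendsto_indicator:
  "(\<lambda>n. bump (1 / Suc n) (a + 1 / Suc n) (y - 1 / Suc n) 1 0 t) \<longlonglongrightarrow> indicator {a<..<y} t"
proof (cases "t \<in> {a<..<y}")
  case True
  let ?e = "\<lambda>n. 1 / real (Suc n)"
  have e: "?e \<longlonglongrightarrow> 0" by (rule lim_1_over_n[THEN LIMSEQ_Suc])
  have lim: "(\<lambda>n. exp (- ?e n / ((t - (a + ?e n)) * (y - ?e n - t)))) \<longlonglongrightarrow> exp (- 0 / ((t - (a + 0)) * (y - 0 - t)))"
    using True by (intro tendsto_intros e) auto
  have "\<forall>\<^sub>F n in sequentially. ?e n < min (t - a) (y - t)"
    using True by (intro order_tendstoD[OF e]) auto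
  then have "\<forall>\<^sub>F n in sequentially. exp (- ?e n / ((t - (a + ?e n)) * (y - ?e n - t)))
      = bump (?e n) (a + ?e n) (y - ?e n) 1 0 t"
    by eventually_elim (auto simp: bump_def)
  from Lim_transform_eventually[OF lim this] show ?thesis using True by simp
next
  case False
  have "bump (1 / Suc n) (a + 1 / Suc n) (y - 1 / Suc n) 1 0 t = 0" for n
  proof -
    have "t \<notin> {a + 1 / Suc n<..<y - 1 / Suc n}"
    proof
      assume t: "t \<in> {a + 1 / Suc n<..<y - 1 / Suc n}"
      have "0 < 1 / real (Suc n)" by simp
      with t have "t \<in> {a<..<y}" unfolding greaterThanLessThan_iff by linarith
      with False show False by simp
    qed
    then show ?thesis by (simp only: bump_def if_False)
  qed
  then show ?thesis using False by simp
qed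

text \<open>The fundamental lemma of the calculus of variations. Bumps converge boundedly to
  indicators of \<open>(a, y)\<close>, so all primitives of the difference vanish. The weak* criterion for a constant
  sequence then allows testing the difference against itself.\<close>

lemma weak_deriv_unique:
  assumes g: "g \<in> Linf {a<..<b}" "weak_deriv {a<..<b} u g"
    and g': "g' \<in> Linf {a<..<b}" "weak_deriv {a<..<b} u g'"
  shows "AE x in lebesgue_on {a<..<b}. g x = g' x"
proof -
  let ?M = "lebesgue_on {a<..<b}"
  define k where "k = (\<lambda>x. g x - g' x)"
  have k: "k \<in> Linf {a<..<b}" unfolding k_def by (rule Linf_diff[OF g(1) g'(1)])
  then obtain B where B: "AE x in ?M. \<bar>k x\<bar> \<le> B" and [measurable]: "k \<in> borel_measurable ?M"
    unfolding Linf_def by blast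
  have kint: "integrable ?M k" by (rule Linf_integrable[OF k]) simp
  have test: "(LINT x|?M. k x * \<phi> x) = 0" if \<phi>: "\<phi> \<in> test_functions {a<..<b}" for \<phi>
  proof -
    have "integrable ?M (\<lambda>x. g x * \<phi> x)" "integrable ?M (\<lambda>x. g' x * \<phi> x)"
      using test_function_Linf(1)[OF \<phi>] g(1) g'(1) by (auto intro!: Linf_integrable Linf_mult)
    moreover have "(LINT x|?M. g x * \<phi> x) = (LINT x|?M. g' x * \<phi> x)"
      using g(2) g'(2) \<phi> unfolding weak_deriv_def by fastforce
    ultimately show ?thesis unfolding k_def by (simp add: left_diff_distrib)
  qed
  have prim: "(LINT t|?M. k t * indicator {..x} t) = 0" for x
  proof -
    define y where "y = min x b"
    let ?\<phi> = "\<lambda>n. bump (1 / Suc n) (a + 1 / Suc n) (y - 1 / Suc n) 1 0"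
    have \<phi>: "?\<phi> n \<in> test_functions {a<..<b}" for n
    proof (rule bump_test_function)
      show "{a + 1 / Suc n..y - 1 / Suc n} \<subseteq> {a<..<b}"
      proof
        fix t assume t: "t \<in> {a + 1 / Suc n..y - 1 / Suc n}"
        have "0 < 1 / real (Suc n)" "y \<le> b" by (simp_all add: y_def)
        with t show "t \<in> {a<..<b}"
          unfolding atLeastAtMost_iff greaterThanLessThan_iff by linarith
      qed
    qed simp
    have [measurable]: "?\<phi> n \<in> borel_measurable ?M" for n
      using test_function_Linf(1)[OF \<phi>] unfolding Linf_def by blast
    have ind[measurable]: "(\<lambda>t. indicator {a<..<y} t :: real) \<in> borel_measurable ?M"
      by (intro measurable_restrict_space1 measurable_completion) auto
    have "(\<lambda>n. LINT t|?M. k t * ?\<phi> n t) \<longlonglongrightarrow> (LINT t|?M. k t * indicator {a<..<y} t)"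
    proof (rule integral_dominated_convergence[where w = "\<lambda>t. \<bar>k t\<bar>"])
      show "AE t in ?M. (\<lambda>n. k t * ?\<phi> n t) \<longlonglongrightarrow> k t * indicator {a<..<y} t"
        by (intro AE_I2 tendsto_mult tendsto_const bump_tendsto_indicator)
      show "AE t in ?M. norm (k t * ?\<phi> n t) \<le> \<bar>k t\<bar>" for n
        using bump_le_1[of "1 / Suc n"] by (intro AE_I2) (simp add: abs_mult mult_left_le)
      show "(\<lambda>t. k t * ?\<phi> n t) \<in> borel_measurable ?M" for n by measurable
    qed (use kint in \<open>measurable, auto\<close>)
    then have 0: "(LINT t|?M. k t * indicator {a<..<y} t) = 0"
      unfolding test[OF \<phi>] by (simp add: LIMSEQ_const_iff)
    have ind': "(\<lambda>t. indicator {..x} t :: real) \<in> borel_measurable ?M"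
      by (intro measurable_restrict_space1 measurable_completion) auto
    have "AE t in lborel. t \<noteq> y" by (rule AE_lborel_singleton)
    then have "AE t in lebesgue. t \<noteq> y" by (rule AE_completion)
    then have "AE t in lebesgue. t \<in> {a<..<b} \<longrightarrow> t \<noteq> y" by eventually_elim simp
    then have "AE t in ?M. t \<noteq> y" by (subst AE_restrict_space_iff) simp_all
    moreover have "AE t in ?M. t \<in> {a<..<b}" using AE_space[of ?M] by simp
    ultimately have "AE t in ?M. k t * indicator {..x} t = k t * indicator {a<..<y} t"
      by eventually_elim (auto simp: indicator_def y_def)
    then have "(LINT t|?M. k t * indicator {..x} t) = (LINT t|?M. k t * indicator {a<..<y} t)"
      using ind ind' by (intro integral_cong_AE) auto
    with 0 show ?thesis by simp
  qed
  have "(\<lambda>n::nat. LINT t|?M. k t * k t) \<longlonglongrightarrow> 0"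
    by (rule weakstar_null_from_primitives[of "\<lambda>_. k" a b B k]) (use B prim kint in auto)
  then have "(LINT t|?M. k t * k t) = 0" by (simp add: LIMSEQ_const_iff)
  moreover have "integrable ?M (\<lambda>t. k t * k t)"
    by (rule Linf_integrable[OF Linf_mult[OF k k]]) simp
  ultimately have "AE t in ?M. k t * k t = 0"
    by (subst (asm) integral_nonneg_eq_0_iff_AE) auto
  then show ?thesis by eventually_elim (simp add: k_def)
qed

section \<open>Primitives of bounded functions\<close>

lemma test_function_outside:
  assumes "\<phi> \<in> test_functions I" "x \<notin> I"
  shows "\<phi> x = 0"
proof -
  have "closure {x. \<phi> x \<noteq> 0} \<subseteq> I" using assms(1) unfolding test_functions_def by blast
  then show ?thesis using assms(2) closure_subset[of "{x. \<phi> x \<noteq> 0}"] by blast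
qed

text \<open>The fundamental theorem of calculus on \<open>[t, b]\<close>, where \<open>\<phi> b = 0\<close>.\<close>

lemma LINT_deriv_tail:
  assumes \<phi>: "\<phi> \<in> test_functions {a<..<b}" and t: "t \<in> {a<..<b}"
  shows "(LINT x|lebesgue_on {a<..<b}. indicator {t..} x * deriv \<phi> x) = - \<phi> t"
proof -
  have c: "continuous_on UNIV (deriv \<phi>)"
    using test_function_deriv(2)[OF \<phi>] by (simp add: continuous_at_imp_continuous_on)
  have m[measurable]: "deriv \<phi> \<in> borel_measurable borel"
    by (rule borel_measurable_continuous_onI[OF c])
  have "(LINT x|lebesgue_on {a<..<b}. indicator {t..} x * deriv \<phi> x)
      = (LINT x|lebesgue. indicator {a<..<b} x * (indicator {t..} x * deriv \<phi> x))"
    by (subst integral_restrict_space) auto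
  also have "\<dots> = (LINT x|lborel. indicator {a<..<b} x * (indicator {t..} x * deriv \<phi> x))"
    by (rule integral_completion) measurable
  also have "\<dots> = (LINT x|lborel. deriv \<phi> x * indicator {t..b} x)"
  proof (rule integral_cong_AE)
    have "AE x in lborel. x \<noteq> b" by (rule AE_lborel_singleton)
    then show "AE x in lborel. indicator {a<..<b} x * (indicator {t..} x * deriv \<phi> x) = deriv \<phi> x * indicator {t..b} x"
      by eventually_elim (use t in \<open>auto simp: indicator_def\<close>)
  qed measurable
  also have "\<dots> = \<phi> b - \<phi> t"
    using t by (intro integral_FTC_Icc_real test_function_deriv[OF \<phi>]) auto
  also have "\<phi> b = 0" using test_function_outside[OF \<phi>] by simp
  finally show ?thesis by simp
qed

text \<open>Integration by parts for a primitive, as an exchange of the order of integration over the triangle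
  \<open>t \<le> x\<close>.\<close>

lemma primitive_weak_deriv:
  assumes k: "k \<in> Linf {a<..<b}"
  defines "w \<equiv> \<lambda>x. LINT t|lebesgue_on {a<..<b}. k t * indicator {..x} t"
  shows "w \<in> Linf {a<..<b}" and "weak_deriv {a<..<b} w k"
proof -
  let ?M = "lebesgue_on {a<..<b}"
  interpret M: finite_measure ?M by (rule finite_measure_lebesgue_on) simp
  interpret P: pair_sigma_finite ?M ?M by unfold_locales
  interpret PM: finite_measure "?M \<Otimes>\<^sub>M ?M"
    by (rule finite_measure_pair_measure) unfold_locales
  have km[measurable]: "k \<in> borel_measurable ?M" using k unfolding Linf_def by blast
  have id[measurable]: "(\<lambda>x. x) \<in> borel_measurable ?M"
    by (intro measurable_restrict_space1 measurable_completion) auto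
  have wm: "(\<lambda>(x, t). k t * indicator {..x} t) \<in> borel_measurable (?M \<Otimes>\<^sub>M ?M)"
  proof -
    have "(\<lambda>p. if snd p \<le> fst p then k (snd p) else 0) \<in> borel_measurable (?M \<Otimes>\<^sub>M ?M)"
      by measurable
    moreover have "(\<lambda>(x, t). k t * indicator {..x} t) = (\<lambda>p. if snd p \<le> fst p then k (snd p) else 0)"
      by (auto simp: indicator_def)
    ultimately show ?thesis by simp
  qed
  have "w \<in> borel_measurable ?M"
    unfolding w_def by (rule M.borel_measurable_lebesgue_integral[OF wm])
  moreover have "\<bar>w x\<bar> \<le> (LINT t|?M. \<bar>k t\<bar>)" for x
  proof -
    have kint: "integrable ?M k" by (rule Linf_integrable[OF k]) simp
    have "\<bar>w x\<bar> \<le> (LINT t|?M. \<bar>k t * indicator {..x} t\<bar>)"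
      unfolding w_def by (rule integral_abs_bound)
    also have "\<dots> \<le> (LINT t|?M. \<bar>k t\<bar>)"
      using kint by (intro integral_mono') (auto simp: indicator_def)
    finally show ?thesis .
  qed
  ultimately show "w \<in> Linf {a<..<b}" unfolding Linf_def by auto
  show "weak_deriv {a<..<b} w k"
    unfolding weak_deriv_def
  proof
    fix \<phi> assume \<phi>: "\<phi> \<in> test_functions {a<..<b}"
    have dm[measurable]: "deriv \<phi> \<in> borel_measurable ?M"
      using test_function_Linf(2)[OF \<phi>] unfolding Linf_def by blast
    define f where "f t x = k t * (indicator {t..} x * deriv \<phi> x)" for t x
    have fm: "case_prod f \<in> borel_measurable (?M \<Otimes>\<^sub>M ?M)"
    proof -
      have "(\<lambda>p. if fst p \<le> snd p then k (fst p) * deriv \<phi> (snd p) else 0) \<in> borel_measurable (?M \<Otimes>\<^sub>M ?M)"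
        by measurable
      moreover have "case_prod f = (\<lambda>p. if fst p \<le> snd p then k (fst p) * deriv \<phi> (snd p) else 0)"
        by (auto simp: indicator_def f_def)
      ultimately show ?thesis by simp
    qed
    obtain C where C: "AE t in ?M. \<bar>k t\<bar> \<le> C" using k unfolding Linf_def by blast
    obtain D where D: "AE x in ?M. \<bar>deriv \<phi> x\<bar> \<le> D"
      using test_function_Linf(2)[OF \<phi>] unfolding Linf_def by blast
    have "AE t in ?M. AE x in ?M. \<bar>f t x\<bar> \<le> \<bar>C\<bar> * \<bar>D\<bar>"
      using C
    proof eventually_elim
      case (elim t)
      from D show ?case
        by eventually_elim
          (use elim in \<open>auto simp: f_def abs_mult indicator_def intro!: mult_mono\<close>)
    qed
    moreover have "{p \<in> space (?M \<Otimes>\<^sub>M ?M). norm (case_prod f p) \<le> \<bar>C\<bar> * \<bar>D\<bar>} \<in> sets (?M \<Otimes>\<^sub>M ?M)"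
      by (rule borel_measurable_le[OF measurable_compose[OF fm borel_measurable_norm] borel_measurable_const])
    ultimately have "AE p in ?M \<Otimes>\<^sub>M ?M. norm (case_prod f p) \<le> \<bar>C\<bar> * \<bar>D\<bar>"
      by (intro P.AE_pair_measure) simp_all
    then have fint: "integrable (?M \<Otimes>\<^sub>M ?M) (case_prod f)"
      by (rule PM.integrable_const_bound[OF _ fm])
    have "(LINT x|?M. w x * deriv \<phi> x) = (LINT x|?M. LINT t|?M. f t x)"
    proof (intro Bochner_Integration.integral_cong refl)
      fix x
      have "(LINT t|?M. f t x) = (LINT t|?M. k t * indicator {..x} t * deriv \<phi> x)"
        by (intro Bochner_Integration.integral_cong) (auto simp: f_def indicator_def)
      then show "w x * deriv \<phi> x = (LINT t|?M. f t x)" by (simp add: w_def)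
    qed
    also have "\<dots> = (LINT t|?M. LINT x|?M. f t x)"
      by (rule P.Fubini_integral[OF fint])
    also have "\<dots> = (LINT t|?M. - (k t * \<phi> t))"
      by (intro Bochner_Integration.integral_cong refl)
        (simp add: f_def LINT_deriv_tail[OF \<phi>])
    finally show "(LINT x|?M. w x * deriv \<phi> x) = - (LINT t|?M. k t * \<phi> t)" by simp
  qed
qed

section \<open>Oscillating indicators\<close>

text \<open>The set \<open>E n\<close> carries in each cell of length \<open>1 / Suc n\<close> exactly the mass of \<open>\<theta>\<close> in that cell: in
  the cell it is one interval starting at the left node, whose length is the increment of the
  primitive \<open>F\<close>. Then the primitive of the
  indicator agrees with \<open>F\<close> at all nodes and, both being monotone, differs from it by at most the
  increment of one cell elsewhere.\<close>

lemma oscillating_indicators: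
  fixes \<theta> :: "real \<Rightarrow> real"
  assumes \<theta>[measurable]: "\<theta> \<in> borel_measurable (lebesgue_on {a<..<b})"
    and \<theta>01: "\<And>x. 0 \<le> \<theta> x" "\<And>x. \<theta> x \<le> 1"
  obtains E :: "nat \<Rightarrow> real set" where "\<And>n. E n \<in> sets borel"
    "\<And>x. (\<lambda>n. LINT t|lebesgue_on {a<..<b}. (indicator (E n) t - \<theta> t) * indicator {..x} t) \<longlonglongrightarrow> 0"
proof -
  let ?M = "lebesgue_on {a<..<b}"
  define F where "F x = (LINT t|?M. \<theta> t * indicator {..x} t)" for x
  have ind: "(\<lambda>t. indicator A t) \<in> Linf {a<..<b}" if "A \<in> sets borel" for A
    unfolding Linf_def using that by (auto intro!: borel_lebesgue_on exI[of _ 1] simp: indicator_def)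
  have \<theta>L: "\<theta> \<in> Linf {a<..<b}"
    unfolding Linf_def using \<theta>01 by (auto intro!: exI[of _ 1])
  have int: "integrable ?M (\<lambda>t. f t * indicator A t)" if "f \<in> Linf {a<..<b}" "A \<in> sets borel" for f A
    by (rule Linf_integrable[OF Linf_mult[OF that(1) ind[OF that(2)]]]) simp
  have measure_M: "(LINT t|?M. indicator A t) = measure lborel (A \<inter> {a<..<b})" if "A \<in> sets borel" for A
    using that by (simp add: measure_restrict_space measure_completion)
  have F_incr: "0 \<le> F y - F x" "F y - F x \<le> measure lborel ({x<..y} \<inter> {a<..<b})" if "x \<le> y" for x y
  proof -
    have "F y - F x = (LINT t|?M. \<theta> t * indicator {..y} t - \<theta> t * indicator {..x} t)"
      unfolding F_def using int[OF \<theta>L] by simp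
    also have "\<dots> = (LINT t|?M. \<theta> t * indicator {x<..y} t)"
      using that by (intro Bochner_Integration.integral_cong) (auto simp: indicator_def)
    finally have eq: "F y - F x = (LINT t|?M. \<theta> t * indicator {x<..y} t)" .
    show "0 \<le> F y - F x"
      unfolding eq using \<theta>01 by (intro Bochner_Integration.integral_nonneg) simp
    have "F y - F x \<le> (LINT t|?M. indicator {x<..y} t)"
      unfolding eq
      by (intro integral_mono int[OF \<theta>L] Linf_integrable[OF ind])
        (use \<theta>01 in \<open>auto simp: indicator_def\<close>)
    then show "F y - F x \<le> measure lborel ({x<..y} \<inter> {a<..<b})"
      using measure_M[of "{x<..y}"] by simp
  qed
  have F_a: "F x = 0" if "x \<le> a" for x
  proof -
    have "F x = (LINT t|?M. 0)"
      unfolding F_def using that by (intro Bochner_Integration.integral_cong) (auto simp: indicator_def)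
    then show ?thesis by simp
  qed
  define node where "node n i = a + real i / Suc n" for n i :: nat
  define L where "L n i = F (node n (Suc i)) - F (node n i)" for n i
  define piece where "piece n i = {node n i<..<node n i + L n i}" for n i
  define E where "E n = (\<Union>i. piece n i)" for n
  have node_step: "node n (Suc i) = node n i + 1 / Suc n" for n i
    unfolding node_def by (simp add: add_divide_distrib)
  have node_mono: "node n i \<le> node n j" if "i \<le> j" for n i j
    unfolding node_def using that by (simp add: divide_right_mono)
  have L0: "0 \<le> L n i" for n i
    unfolding L_def by (rule F_incr) (rule node_mono, simp)
  have L_le: "L n i \<le> measure lborel ({node n i<..node n (Suc i)} \<inter> {a<..<b})" for n i
    unfolding L_def by (rule F_incr) (rule node_mono, simp)
  have fm_bdd: "A \<in> fmeasurable lborel" if "A \<in> sets borel" "bounded A" for A :: "real set"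
    using that by (intro fmeasurableI emeasure_bounded_finite) auto
  have L_step: "L n i \<le> 1 / Suc n" for n i
  proof -
    have "L n i \<le> measure lborel {node n i<..node n (Suc i)}"
      by (rule order_trans[OF L_le]) (intro measure_mono_fmeasurable fm_bdd, auto)
    then show ?thesis by (simp add: node_step)
  qed
  have piece_sub: "piece n i \<subseteq> {node n i<..<node n (Suc i)}" for n i
    unfolding piece_def node_step using L_step[of n i] by auto
  \<comment> \<open>Beyond \<open>b\<close> the primitive is constant, so the infinitely many nodes need no cut-off and the
    last piece does not leave the interval.\<close>
  have piece_I: "piece n i \<subseteq> {a<..<b}" for n i
  proof (cases "node n i < b")
    case True
    have "L n i \<le> measure lborel {node n i<..<b}"
      by (rule order_trans[OF L_le]) (intro measure_mono_fmeasurable fm_bdd, auto)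
    then have "node n i + L n i \<le> b" using True by simp
    moreover have "a \<le> node n i" by (simp add: node_def)
    ultimately show ?thesis unfolding piece_def by auto
  next
    case False
    then have "{node n i<..node n (Suc i)} \<inter> {a<..<b} = {}" by auto
    then show ?thesis unfolding piece_def using L_le[of n i] by auto
  qed
  have E_sets: "E n \<in> sets borel" for n unfolding E_def piece_def by auto
  have prefix: "E n \<inter> {..<node n k} = (\<Union>i<k. piece n i)" for n k
  proof -
    have "i < k" if "t \<in> piece n i" "t < node n k" for i t
      using that piece_sub[of n i] node_mono[of k i n] by (cases "i < k") auto
    moreover have "t < node n k" if "t \<in> piece n i" "i < k" for i t
      using that piece_sub[of n i] node_mono[of "Suc i" k n] by auto
    ultimately show ?thesis unfolding E_def by blast
  qed
  have meas_prefix: "measure lborel (E n \<inter> {..<node n k}) = F (node n k)" for n k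
  proof (induction k)
    case 0
    then show ?case unfolding prefix by (simp add: F_a node_def)
  next
    case (Suc k)
    have eq: "E n \<inter> {..<node n (Suc k)} = (E n \<inter> {..<node n k}) \<union> piece n k"
      unfolding prefix by (auto simp: lessThan_Suc)
    have fin: "E n \<inter> {..<node n k} \<in> fmeasurable lborel"
      unfolding prefix piece_def
      by (intro fm_bdd) (auto intro!: bounded_UN)
    have "measure lborel (E n \<inter> {..<node n (Suc k)})
        = measure lborel (E n \<inter> {..<node n k}) + measure lborel (piece n k)"
      unfolding eq
      by (rule measure_Un_AE[OF _ fin fm_bdd]) (auto simp: piece_def)
    also have "measure lborel (piece n k) = L n k" unfolding piece_def using L0 by simp
    finally show ?case using Suc by (simp add: L_def)
  qed
  have close: "\<bar>LINT t|?M. (indicator (E n) t - \<theta> t) * indicator {..x} t\<bar> \<le> 1 / Suc n" for n x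
  proof (cases "x < a")
    case True
    have "(LINT t|?M. (indicator (E n) t - \<theta> t) * indicator {..x} t) = (LINT t|?M. 0)"
      using True by (intro Bochner_Integration.integral_cong) (auto simp: indicator_def)
    then show ?thesis by simp
  next
    case False
    define k where "k = nat \<lfloor>(x - a) * Suc n\<rfloor>"
    have k: "real k \<le> (x - a) * Suc n" "(x - a) * Suc n < real k + 1"
      unfolding k_def using False by auto
    have x: "node n k \<le> x" "x < node n (Suc k)"
      using k unfolding node_def by (auto simp: field_simps)
    have fin: "E n \<inter> A \<in> fmeasurable lborel" if "A \<in> sets borel" for A

    using that E_sets piece_I
    by (intro fm_bdd bounded_subset[of "{a<..<b}" "E n \<inter> A"]) (auto simp: E_def)
    have "(LINT t|?M. (indicator (E n) t - \<theta> t) * indicator {..x} t)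
        = (LINT t|?M. indicator (E n) t * indicator {..x} t) - F x"
      unfolding F_def left_diff_distrib using int[OF ind[OF E_sets]] int[OF \<theta>L] by simp
    also have "(LINT t|?M. indicator (E n) t * indicator {..x} t) = (LINT t|?M. indicator (E n \<inter> {..x}) t :: real)"
      by (intro Bochner_Integration.integral_cong) (auto simp: indicator_def)
    also have "\<dots> = measure lborel (E n \<inter> {..x})"
    proof -
      have "E n \<inter> {..x} \<inter> {a<..<b} = E n \<inter> {..x}" using piece_I unfolding E_def by blast
      then show ?thesis using E_sets measure_M[of "E n \<inter> {..x}"] by simp
    qed
    finally have eq: "(LINT t|?M. (indicator (E n) t - \<theta> t) * indicator {..x} t)
        = measure lborel (E n \<inter> {..x}) - F x" .
    have "measure lborel (E n \<inter> {..<node n k}) \<le> measure lborel (E n \<inter> {..x})"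
      by (intro measure_mono_fmeasurable fin) (use x E_sets in auto)
    moreover have "measure lborel (E n \<inter> {..x}) \<le> measure lborel (E n \<inter> {..<node n (Suc k)})"
      by (intro measure_mono_fmeasurable fin) (use x E_sets in auto)
    moreover have "F (node n k) \<le> F x" "F x \<le> F (node n (Suc k))"
      using F_incr(1)[of "node n k" x] F_incr(1)[of x "node n (Suc k)"] x by auto
    ultimately show ?thesis
      unfolding eq meas_prefix using L_step[of n k] unfolding L_def by linarith
  qed
  show ?thesis
  proof (rule that[OF E_sets])
    fix x
    show "(\<lambda>n. LINT t|?M. (indicator (E n) t - \<theta> t) * indicator {..x} t) \<longlonglongrightarrow> 0"
      by (rule Lim_null_comparison[OF _ lim_1_over_n[THEN LIMSEQ_Suc]]) (use close in auto)
  qed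
qed

section \<open>The recovery sequence\<close>

lemma weak_deriv_add_scaled:
  assumes L: "u \<in> Linf {a<..<b}" "g \<in> Linf {a<..<b}" "w \<in> Linf {a<..<b}" "k \<in> Linf {a<..<b}"
    and d: "weak_deriv {a<..<b} u g" "weak_deriv {a<..<b} w k"
  shows "weak_deriv {a<..<b} (\<lambda>x. u x + c * w x) (\<lambda>x. g x + c * k x)"
  unfolding weak_deriv_def
proof
  fix \<phi> assume \<phi>: "\<phi> \<in> test_functions {a<..<b}"
  let ?M = "lebesgue_on {a<..<b}"
  have int: "integrable ?M (\<lambda>x. f x * \<psi> x)" if "f \<in> Linf {a<..<b}" "\<psi> \<in> Linf {a<..<b}" for f \<psi>
    by (rule Linf_integrable[OF Linf_mult[OF that]]) simp
  note \<phi>L = test_function_Linf[OF \<phi>]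
  have "(LINT x|?M. (u x + c * w x) * deriv \<phi> x) = (LINT x|?M. u x * deriv \<phi> x + c * (w x * deriv \<phi> x))"
    by (simp add: algebra_simps)
  also have "\<dots> = (LINT x|?M. u x * deriv \<phi> x) + c * (LINT x|?M. w x * deriv \<phi> x)"
    using int[OF L(1) \<phi>L(2)] int[OF L(3) \<phi>L(2)] by simp
  also have "\<dots> = - ((LINT x|?M. g x * \<phi> x) + c * (LINT x|?M. k x * \<phi> x))"
    using d \<phi> unfolding weak_deriv_def by simp
  also have "(LINT x|?M. g x * \<phi> x) + c * (LINT x|?M. k x * \<phi> x) = (LINT x|?M. g x * \<phi> x + c * (k x * \<phi> x))"
    using int[OF L(2) \<phi>L(1)] int[OF L(4) \<phi>L(1)] by simp
  also have "\<dots> = (LINT x|?M. (g x + c * k x) * \<phi> x)"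
    by (simp add: algebra_simps)
  finally show "(LINT x|?M. (u x + c * w x) * deriv \<phi> x) = - (LINT x|?M. (g x + c * k x) * \<phi> x)" .
qed

text \<open>Write \<open>u' = \<alpha> + (\<beta> - \<alpha>) \<theta>\<close> with \<open>\<theta>\<close> between 0 and 1 and replace \<open>\<theta>\<close> by oscillating indicators. The
  recovery sequence adds to \<open>u\<close> the primitives of the differences, so its derivatives
  take only the values \<open>\<alpha>\<close> and \<open>\<beta>\<close>, and \<open>J1d\<close> sees only the four corners of the square. Correcting
  \<open>u\<close> itself, rather than integrating the new derivative, avoids having to represent \<open>u\<close> as
  a primitive of its weak derivative.\<close>

lemma range_in_square_imp_J1d_rlx_le:
  assumes V: "lower_semicontinuous V" "diagonal_density V" "symmetric_density V"
    and u: "u \<in> W1inf {a<..<b}"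
    and sq: "range_in_square {a<..<b} V (wderiv {a<..<b} u) c"
  shows "J1d_rlx {a<..<b} V u \<le> ereal c"
proof -
  let ?I = "{a<..<b}" let ?M = "lebesgue_on {a<..<b}"
  interpret finite_measure ?M by (rule finite_measure_lebesgue_on) simp
  define g where "g = wderiv ?I u"
  have g: "g \<in> Linf ?I" "weak_deriv ?I u g"
    unfolding g_def using wderiv_W1inf[OF u] by auto
  have uL: "u \<in> Linf ?I" using u unfolding W1inf_def by blast
  have [measurable]: "g \<in> borel_measurable ?M" using g(1) unfolding Linf_def by blast
  obtain \<alpha> \<beta> where \<alpha>\<beta>: "V (\<alpha>, \<beta>) \<le> c" "AE x in ?M. g x \<in> {\<alpha>..\<beta>}"
    using sq unfolding range_in_square_def g_def by blast
  \<comment> \<open>If \<open>\<alpha> = \<beta>\<close> the quotient is 0 by convention, and the representation of \<open>u'\<close> still holds. The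
    truncation only acts on a null set.\<close>
  define \<theta> where "\<theta> x = max 0 (min 1 ((g x - \<alpha>) / (\<beta> - \<alpha>)))" for x
  have \<theta>m[measurable]: "\<theta> \<in> borel_measurable ?M" unfolding \<theta>_def by measurable
  have \<theta>01: "0 \<le> \<theta> x" "\<theta> x \<le> 1" for x unfolding \<theta>_def by auto
  have g\<theta>: "AE x in ?M. g x = \<alpha> + (\<beta> - \<alpha>) * \<theta> x"
    using \<alpha>\<beta>(2)
  proof eventually_elim
    case (elim x)
    then have "(\<beta> - \<alpha>) * ((g x - \<alpha>) / (\<beta> - \<alpha>)) = g x - \<alpha>" by auto
    moreover have "0 \<le> (g x - \<alpha>) / (\<beta> - \<alpha>)" "(g x - \<alpha>) / (\<beta> - \<alpha>) \<le> 1"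
      using elim by (auto simp: divide_le_eq_1)
    ultimately show ?case unfolding \<theta>_def by (simp add: max_def min_def)
  qed
  obtain E :: "nat \<Rightarrow> real set" where E: "\<And>n. E n \<in> sets borel"
    "\<And>x. (\<lambda>n. LINT t|?M. (indicator (E n) t - \<theta> t) * indicator {..x} t) \<longlonglongrightarrow> 0"
    using oscillating_indicators[OF \<theta>m \<theta>01] by blast
  define k where "k n t = indicator (E n) t - \<theta> t" for n t
  have km[measurable]: "k n \<in> borel_measurable ?M" for n
    unfolding k_def using E(1) by (intro borel_measurable_diff \<theta>m borel_lebesgue_on) auto
  have k1: "\<bar>k n t\<bar> \<le> 1" for n t
    unfolding k_def using \<theta>01[of t] by (auto simp: indicator_def abs_le_iff)
  have kL: "k n \<in> Linf ?I" for n unfolding Linf_def using k1 km by auto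
  have kprim: "(\<lambda>n. LINT t|?M. k n t * indicator {..x} t) \<longlonglongrightarrow> 0" for x
    using E(2) unfolding k_def .
  define w where "w n x = (LINT t|?M. k n t * indicator {..x} t)" for n x
  have wL: "w n \<in> Linf ?I" and wd: "weak_deriv ?I (w n) (k n)" for n
    using primitive_weak_deriv[OF kL[of n]] unfolding w_def[abs_def] by auto
  have w_bound: "\<bar>w n x\<bar> \<le> measure ?M (space ?M)" for n x
  proof -
    have "\<bar>w n x\<bar> \<le> (LINT t|?M. \<bar>k n t * indicator {..x} t\<bar>)"
      unfolding w_def by (rule integral_abs_bound)
    also have "\<dots> \<le> (LINT t|?M. 1)"
      using k1[of n] by (intro integral_mono') (auto simp: indicator_def)
    finally show ?thesis by simp
  qed
  define v where "v n x = u x + (\<beta> - \<alpha>) * w n x" for n x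
  have vL: "v n \<in> Linf ?I" for n
    unfolding v_def by (intro Linf_add uL Linf_mult Linf_const wL)
  have gL: "(\<lambda>x. g x + (\<beta> - \<alpha>) * k n x) \<in> Linf ?I" for n
    by (intro Linf_add g(1) Linf_mult Linf_const kL)
  have vd: "weak_deriv ?I (v n) (\<lambda>x. g x + (\<beta> - \<alpha>) * k n x)" for n
    unfolding v_def by (rule weak_deriv_add_scaled[OF uL g(1) wL kL g(2) wd])
  have vW: "v n \<in> W1inf ?I" for n
    unfolding W1inf_def using vL vd gL by blast
  have v': "AE x in ?M. wderiv ?I (v n) x = g x + (\<beta> - \<alpha>) * k n x" for n
    by (rule weak_deriv_unique[OF wderiv_W1inf[OF vW] gL vd])
  have J: "J1d ?I V (v n) \<le> ereal c" for n
  proof (rule range_in_vertices_imp_J1d_le[OF V wderiv_W1inf(1)[OF vW] \<alpha>\<beta>(1)])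
    from v'[of n] g\<theta> show "AE x in ?M. wderiv ?I (v n) x \<in> {\<alpha>, \<beta>}"
    proof eventually_elim
      case (elim x)
      then have "wderiv ?I (v n) x = \<alpha> + (\<beta> - \<alpha>) * indicator (E n) x"
        by (simp add: k_def algebra_simps)
      then show ?case by (cases "x \<in> E n") auto
    qed
  qed
  have "weakstar_Linf ?I v u"
    unfolding weakstar_Linf_def
  proof (intro allI impI)
    fix h :: "real \<Rightarrow> real" assume h: "integrable ?M h"
    have [measurable]: "w n \<in> borel_measurable ?M" for n
      using wL[of n] unfolding Linf_def by blast
    have "(\<lambda>n. LINT x|?M. w n x * h x) \<longlonglongrightarrow> (LINT x|?M. 0)"
    proof (rule integral_dominated_convergence[where w = "\<lambda>x. measure ?M (space ?M) * \<bar>h x\<bar>"])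
      show "AE x in ?M. (\<lambda>n. w n x * h x) \<longlonglongrightarrow> 0"
        by (intro AE_I2 tendsto_mult_left_zero) (use kprim in \<open>simp add: w_def\<close>)
      show "AE x in ?M. norm (w n x * h x) \<le> measure ?M (space ?M) * \<bar>h x\<bar>" for n
        using w_bound[of n] by (intro AE_I2) (auto simp: abs_mult intro!: mult_right_mono)
      show "(\<lambda>x. w n x * h x) \<in> borel_measurable ?M" for n using h by measurable
    qed (use h in auto)
    then have "(\<lambda>n. (LINT x|?M. u x * h x) + (\<beta> - \<alpha>) * (LINT x|?M. w n x * h x))
        \<longlonglongrightarrow> (LINT x|?M. u x * h x) + (\<beta> - \<alpha>) * 0"
      by (intro tendsto_intros) simp
    moreover have "(LINT x|?M. v n x * h x) = (LINT x|?M. u x * h x) + (\<beta> - \<alpha>) * (LINT x|?M. w n x * h x)" for n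
      using Linf_mult_integrable[OF uL h] Linf_mult_integrable[OF wL h]
      unfolding v_def by (simp add: distrib_right mult.assoc)
    ultimately show "(\<lambda>n. LINT x|?M. v n x * h x) \<longlonglongrightarrow> (LINT x|?M. u x * h x)" by simp
  qed
  moreover have "weakstar_Linf ?I (\<lambda>n. wderiv ?I (v n)) (wderiv ?I u)"
    unfolding weakstar_Linf_def g_def[symmetric]
  proof (intro allI impI)
    fix h :: "real \<Rightarrow> real" assume h: "integrable ?M h"
    have "(\<lambda>n. LINT x|?M. k n x * h x) \<longlonglongrightarrow> 0"
      by (rule weakstar_null_from_primitives[OF km _ kprim h, of 1]) (use k1 in auto)
    then have "(\<lambda>n. (LINT x|?M. g x * h x) + (\<beta> - \<alpha>) * (LINT x|?M. k n x * h x))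
        \<longlonglongrightarrow> (LINT x|?M. g x * h x) + (\<beta> - \<alpha>) * 0"
      by (intro tendsto_intros)
    moreover have "(LINT x|?M. wderiv ?I (v n) x * h x)
        = (LINT x|?M. g x * h x) + (\<beta> - \<alpha>) * (LINT x|?M. k n x * h x)" for n
    proof -
      have "(LINT x|?M. wderiv ?I (v n) x * h x) = (LINT x|?M. (g x + (\<beta> - \<alpha>) * k n x) * h x)"
      proof (rule integral_cong_AE)
        show "(\<lambda>x. wderiv ?I (v n) x * h x) \<in> borel_measurable ?M"
          by (rule borel_measurable_integrable[OF Linf_mult_integrable[OF wderiv_W1inf(1)[OF vW] h]])
        show "(\<lambda>x. (g x + (\<beta> - \<alpha>) * k n x) * h x) \<in> borel_measurable ?M"
          by (rule borel_measurable_integrable[OF Linf_mult_integrable[OF gL h]])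
        from v'[of n] show "AE x in ?M. wderiv ?I (v n) x * h x = (g x + (\<beta> - \<alpha>) * k n x) * h x"
          by eventually_elim simp
      qed
      also have "\<dots> = (LINT x|?M. g x * h x) + (\<beta> - \<alpha>) * (LINT x|?M. k n x * h x)"
        using Linf_mult_integrable[OF g(1) h] Linf_mult_integrable[OF kL h]
        by (simp add: distrib_right mult.assoc)
      finally show ?thesis .
    qed
    ultimately show "(\<lambda>n. LINT x|?M. wderiv ?I (v n) x * h x) \<longlonglongrightarrow> (LINT x|?M. g x * h x)" by simp
  qed
  ultimately have "weakstar_W1inf ?I v u" unfolding weakstar_W1inf_def ..
  with vW have "J1d_rlx ?I V u \<le> liminf (\<lambda>n. J1d ?I V (v n))"
    unfolding J1d_rlx_def by (intro Inf_lower) blast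
  also have "\<dots> \<le> liminf (\<lambda>n. ereal c)"
    by (intro Liminf_mono always_eventually allI J)
  also have "\<dots> = ereal c" by (simp add: Liminf_const)
  finally show ?thesis .
qed

theorem theorem1p2:
  fixes a b :: real and V :: "real \<times> real \<Rightarrow> real" and u :: "real \<Rightarrow> real"
  assumes "a < b"
    and "coercive V"
    and "lower_semicontinuous V"
    and "diagonal_density V"
    and "symmetric_density V"
    and "u \<in> W1inf {a<..<b}"
  shows "J1d_rlx {a<..<b} V u =
    esssup (lebesgue_on ({a<..<b} \<times> {a<..<b}))
      (\<lambda>(x, y). ereal (slc_envelope V (wderiv {a<..<b} u x, wderiv {a<..<b} u y)))"
    (is "?J = ?S")
proof -
  have "?J \<le> ereal c \<longleftrightarrow> ?S \<le> ereal c" for c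
    using J1d_rlx_le_imp_range_in_square[OF assms(2-5) assms(1) assms(6)]
      range_in_square_imp_J1d_rlx_le[OF assms(3-6)]
      esssup_slc_envelope_le_iff[OF assms(2-5) assms(1) wderiv_W1inf(1)[OF assms(6)]]
    by blast
  then have "?J \<le> ?S" "?S \<le> ?J" by (auto intro: ereal_le_real)
  then show ?thesis by (rule antisym)
qed

end
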